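(* Let $r\in\mathbb{N}$. For large $n$, let $\rho\in(0,1)$ and $\widetilde\rho\in(0,1)$ be the solutions of \[ n=\rho\,\Phi'_{\mathbb{P}_r}(\rho)\quad\text{and}\quad n=\widetilde\rho\,\Phi'_{\Lambda^{*r}}(\widetilde\rho). \] Then as $n\to\infty$, \[ \mathfrak{p}_{\mathbb{P}_r}(n)=\frac{\rho^{-n}\Psi_{\mathbb{P}_r}(\rho)}{\big(2\pi\Phi_{\mathbb{P}_r,(2)}(\rho)\big)^{1/2}}\big(1+O(n^{-1/6})\big),\qquad \mathfrak{p}_{\Lambda^{*r}}(n)=\frac{\widetilde\rho^{\,-n}\Psi_{\Lambda^{*r}}(\widetilde\rho)}{\big(2\pi\Phi_{\Lambda^{*r},(2)}(\widetilde\rho)\big)^{1/2}}\big(1+O(n^{-1/6})\big), \] where $\Phi_{\mathbb{P}_r,(2)}(\rho)=(\rho\frac{d}{d\rho})^2\Phi_{\mathbb{P}_r}(\rho)$ and $\Phi_{\Lambda^{*r},(2)}(\rho)=(\rho\frac{d}{d\rho})^2\Phi_{\Lambda^{*r}}(\rho)$.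
   Context: $\mathbb{P}$ is the set of primes and $\Lambda^{*r}$ the $r$-fold Dirichlet convolution of the von Mangoldt function. For $|z|<1$: $\Psi_{\mathbb{P}_r}(z)=\sum_{n\ge0}\mathfrak{p}_{\mathbb{P}_r}(n)z^n:=\prod_{(p_1,\dots,p_r)\in\mathbb{P}^r}(1-z^{p_1\cdots p_r})^{-1}$ (product over ordered $r$-tuples), $\Psi_{\Lambda^{*r}}(z)=\sum_{n\ge0}\mathfrak{p}_{\Lambda^{*r}}(n)z^n:=\prod_{m\ge1}(1-z^m)^{-\Lambda^{*r}(m)}$, and $\Psi_{\mathbb{P}_r}=\exp(\Phi_{\mathbb{P}_r})$, $\Psi_{\Lambda^{*r}}=\exp(\Phi_{\Lambda^{*r}})$ with $\Phi_{\mathbb{P}_r}(z)=\sum_{j\ge1}\frac1j\sum_{(p_1,\dots,p_r)\in\mathbb{P}^r}z^{jp_1\cdots p_r}$ and $\Phi_{\Lambda^{*r}}(z)=\sum_{j\ge1}\frac1j\sum_{m\ge1}\Lambda^{*r}(m)z^{jm}$. Since these have nonnegative coefficients, the saddle point equations have unique solutions in $(0,1)$ for large $n$. *)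

theory Defs
  imports "HOL-Complex_Analysis.Complex_Analysis" "HOL-Number_Theory.Prime_Powers"
begin

definition prime_tuples :: "nat \<Rightarrow> nat list set" where
  "prime_tuples r = {ps. length ps = r \<and> (\<forall>p\<in>set ps. prime p)}"

text \<open>Unordered (unconditional) infinite product over an index set, the multiplicative
  analogue of \<^const>\<open>infsum\<close>.\<close>

definition unordered_prod :: "('a \<Rightarrow> complex) \<Rightarrow> 'a set \<Rightarrow> complex" where
  "unordered_prod f A = Lim (finite_subsets_at_top A) (\<lambda>X. \<Prod>x\<in>X. f x)"

definition Psi_P :: "nat \<Rightarrow> complex \<Rightarrow> complex" where
  "Psi_P r z = unordered_prod (\<lambda>ps. inverse (1 - z ^ prod_list ps)) (prime_tuples r)"

definition Phi_P :: "nat \<Rightarrow> complex \<Rightarrow> complex" where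
  "Phi_P r z = (\<Sum>j. 1 / of_nat (Suc j) * (\<Sum>\<^sub>\<infinity>ps\<in>prime_tuples r. z ^ (Suc j * prod_list ps)))"

definition dirichlet_conv :: "(nat \<Rightarrow> real) \<Rightarrow> (nat \<Rightarrow> real) \<Rightarrow> nat \<Rightarrow> real" where
  "dirichlet_conv f g n = (\<Sum>d | d dvd n. f d * g (n div d))"

text \<open>The base case is the unit of Dirichlet convolution on positive integers; the value
  at \<open>0\<close> is never used.\<close>

primrec mangoldt_conv :: "nat \<Rightarrow> nat \<Rightarrow> real" where
  "mangoldt_conv 0 = (\<lambda>n. if n = 1 then 1 else 0)"
| "mangoldt_conv (Suc r) = dirichlet_conv mangoldt (mangoldt_conv r)"

text \<open>In the two definitions below the index \<open>m\<close> is shifted by one. For \<open>norm z < 1\<close>, the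
  base \<open>1 - z ^ Suc m\<close> lies in the right half-plane, so the principal branch is the one
  with value \<open>1\<close> at \<open>z = 0\<close>.\<close>

definition Psi_L :: "nat \<Rightarrow> complex \<Rightarrow> complex" where
  "Psi_L r z = (\<Prod>m. (1 - z ^ Suc m) powr (- of_real (mangoldt_conv r (Suc m))))"

definition Phi_L :: "nat \<Rightarrow> complex \<Rightarrow> complex" where
  "Phi_L r z = (\<Sum>j. 1 / of_nat (Suc j) *
     (\<Sum>m. of_real (mangoldt_conv r (Suc m)) * z ^ (Suc j * Suc m)))"

definition part_P :: "nat \<Rightarrow> nat \<Rightarrow> complex" where
  "part_P r n = fps_nth (fps_expansion (Psi_P r) 0) n"

definition part_L :: "nat \<Rightarrow> nat \<Rightarrow> complex" where
  "part_L r n = fps_nth (fps_expansion (Psi_L r) 0) n"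

definition euler_op :: "(complex \<Rightarrow> complex) \<Rightarrow> complex \<Rightarrow> complex" where
  "euler_op f = (\<lambda>z. z * deriv f z)"

definition saddle_point :: "(complex \<Rightarrow> complex) \<Rightarrow> nat \<Rightarrow> real \<Rightarrow> bool" where
  "saddle_point \<Phi> n \<rho> \<longleftrightarrow>
     0 < \<rho> \<and> \<rho> < 1 \<and> of_nat n = complex_of_real \<rho> * deriv \<Phi> (complex_of_real \<rho>)"

definition saddle_main ::
    "(complex \<Rightarrow> complex) \<Rightarrow> (complex \<Rightarrow> complex) \<Rightarrow> nat \<Rightarrow> real \<Rightarrow> complex" where
  "saddle_main \<Psi> \<Phi> n \<rho> =
     complex_of_real \<rho> powi (- int n) * \<Psi> (complex_of_real \<rho>) /
       csqrt (2 * complex_of_real pi * (euler_op ^^ 2) \<Phi> (complex_of_real \<rho>))"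

end

theory Submission
  imports Defs "HOL-Probability.Characteristic_Functions" "HOL-Real_Asymp.Real_Asymp"
begin

text \<open>
  Both generating functions have the form \<open>exp \<Phi>\<close> with \<open>\<Phi> z = (\<Sum>k. b k * z ^ k)\<close>, where \<open>b\<close> is
  nonnegative, grows more slowly than \<open>k powr (1/100)\<close>, and is bounded below at \<open>s * p\<close> for all
  primes \<open>p\<close> and two fixed coprime numbers \<open>s\<close>; these three properties suffice. On the circle
  \<open>z = exp (- t) * cis \<theta>\<close> the exponent is quadratic up to a cubic error controlled by the third
  moment of \<open>b m * exp (- t * m)\<close>, which gives a relative error of about \<open>t powr (1/2)\<close>, while \<open>n\<close> is
  about \<open>1 / t\<^sup>2\<close>.

  Away from the saddle point no exponential sum over primes is needed: it is enough that
  \<open>1 - cos (p * \<theta>)\<close> is not small for a power of \<open>1 / t\<close> many primes \<open>p \<le> 1 / t\<close>. With a Dirichlet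
  approximation \<open>h / k\<close> to \<open>\<theta> / (2 * pi)\<close>, small \<open>k \<ge> 2\<close> is handled by \<open>p\<close> not being a multiple of
  \<open>k\<close>, and large \<open>k\<close> by counting: fewer integers \<open>n \<le> 1 / t\<close> have \<open>n * \<theta> / (2 * pi)\<close> close to an
  integer than there are primes, by Chebyshev's lower bound.
\<close>

section \<open>Chebyshev's lower bound\<close>

text \<open>The claimed rate \<open>n powr (-1/6)\<close> corresponds to about
  \<open>t powr (1/3)\<close>, so there is slack against \<open>t powr (1/2)\<close>. It pays for
  crude input: every logarithm is traded for a small loss, mostly \<open>1/100\<close>, in an
  exponent. Let \<open>A\<close> and \<open>B\<close> be the second and third moments. Up to
  constants, \<open>A \<ge> t powr (-297/100)\<close> and \<open>B \<le> t powr (-401/100)\<close>,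
  so the relative error \<open>B / A powr (3/2)\<close> is at most \<open>t powr (445/1000)\<close>;
  this is below \<open>t powr (2/5)\<close>, which suffices since \<open>n\<close> is at most of
  order \<open>t powr (-201/100)\<close>. There is no intermediate arc. The quadratic approximation
  is used as far as the cubic error allows, up to
  \<open>\<bar>\<theta>\<bar> = 3 * A / (2 * B)\<close>, which is nearly of order \<open>t\<close>;
  the bound for the rest of the circle is already strong there. For \<open>r \<ge> 2\<close> the
  weights vanish at the primes themselves. They are bounded below at products of \<open>r\<close>
  primes, and \<open>q ^ (r - 1) * p\<close> with \<open>q = 2\<close> or \<open>q = 3\<close> is
  the source of the two multipliers.\<close>

definition primes_upto :: "real \<Rightarrow> nat set" where
  "primes_upto x = {p. prime p \<and> real p \<le> x}"

lemma finite_primes_upto [simp]: "finite (primes_upto x)"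
proof (rule finite_subset)
  show "primes_upto x \<subseteq> {..nat \<lfloor>x\<rfloor>}"
    by (auto simp: primes_upto_def le_nat_floor)
qed auto

lemma primes_upto_mono: "x \<le> y \<Longrightarrow> primes_upto x \<subseteq> primes_upto y"
  by (auto simp: primes_upto_def)

text \<open>Summing \<open>ln k = (\<Sum>d | d dvd k. mangoldt d)\<close> over
  \<open>k \<le> n\<close> counts each \<open>d\<close> once per multiple up to \<open>n\<close>.
  The free upper limit \<open>N\<close> puts \<open>ln (fact n)\<close> and
  \<open>ln (fact (2*n))\<close> over one range of \<open>d\<close>.\<close>

lemma ln_fact_eq_sum_mangoldt:
  assumes "n \<le> N"
  shows "ln (fact n) = (\<Sum>d=1..N. mangoldt d * real (n div d))"
  using assms
proof (induction n)
  case (Suc n)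
  have "ln (fact (Suc n) :: real) = ln (real (Suc n)) + ln (fact n)"
    by (simp add: ln_mult)
  also have "ln (real (Suc n)) = (\<Sum>d | d dvd Suc n. mangoldt d)"
    by (subst mangoldt_sum) auto
  also have "\<dots> = (\<Sum>d=1..N. if d dvd Suc n then mangoldt d else 0)"
  proof (intro sum.mono_neutral_cong_left)
    show "{d. d dvd Suc n} \<subseteq> {1..N}"
    proof
      fix d assume "d \<in> {d. d dvd Suc n}"
      then have "d dvd Suc n" by simp
      then have "d \<le> Suc n" "d > 0" by (auto intro: dvd_imp_le dvd_pos_nat)
      then show "d \<in> {1..N}" using Suc.prems by simp
    qed
  qed auto
  also have "\<dots> + ln (fact n) = (\<Sum>d=1..N. mangoldt d * real (Suc n div d))"
    using Suc.prems unfolding Suc.IH[OF Suc_leD[OF Suc.prems]] sum.distrib [symmetric]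
    by (intro sum.cong) (auto simp: div_Suc dvd_eq_mod_eq_0 algebra_simps)
  finally show ?case .
qed simp

text \<open>A prime \<open>p\<close> contributes \<open>ln p\<close> once for each of its powers up
  to \<open>N\<close>, hence at most \<open>log p N * ln p = ln N\<close>.\<close>

lemma sum_mangoldt_le:
  assumes "N > 0"
  shows "(\<Sum>d=1..N. mangoldt d) \<le> real (card (primes_upto (real N))) * ln (real N)"
proof -
  let ?D = "{d\<in>{1..N}. primepow d}" and ?P = "primes_upto (real N)"
  have ap: "aprimedivisor d \<in> ?P" if "d \<in> ?D" for d
    using that primepow_gt_Suc_0[of d] aprimedivisor_le_nat[of d] prime_aprimedivisor'[of d]
    by (auto simp: primes_upto_def)
  have "(\<Sum>d=1..N. mangoldt d) = (\<Sum>d\<in>?D. ln (real (aprimedivisor d)))"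
    by (intro sum.mono_neutral_cong_right) (auto simp: mangoldt_def)
  also have "\<dots> = (\<Sum>p\<in>?P. \<Sum>d\<in>{d\<in>?D. aprimedivisor d = p}. ln (real (aprimedivisor d)))"
    using ap by (intro sum.group [symmetric]) auto
  also have "\<dots> \<le> (\<Sum>p\<in>?P. ln (real N))"
  proof (intro sum_mono)
    fix p assume p: "p \<in> ?P"
    then have pp: "prime p" by (simp add: primes_upto_def)
    then have p2: "real p \<ge> 2" using prime_ge_2_nat[of p] by linarith
    have sub: "{d\<in>?D. aprimedivisor d = p} \<subseteq> (\<lambda>k. p ^ k) ` {1..nat \<lfloor>log p N\<rfloor>}"
    proof
      fix d assume d: "d \<in> {d\<in>?D. aprimedivisor d = p}"
      then obtain q k where qk: "prime q" "k > 0" "d = q ^ k" by (auto simp: primepow_def)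
      then have "q = p" using d by (simp add: aprimedivisor_prime_power)
      moreover have "real k \<le> log p N"
        using d qk \<open>q = p\<close> p2 assms by (subst le_log_iff) (auto simp: powr_realpow simp flip: of_nat_power)
      ultimately show "d \<in> (\<lambda>k. p ^ k) ` {1..nat \<lfloor>log p N\<rfloor>}"
        using qk by (auto simp: le_nat_floor)
    qed
    have "card {d\<in>?D. aprimedivisor d = p} \<le> nat \<lfloor>log p N\<rfloor>"
      using surj_card_le[OF _ sub] by simp
    also have "real (nat \<lfloor>log p N\<rfloor>) \<le> log p N"
      using p2 assms by (intro of_nat_floor) (auto simp: log_def)
    finally have "real (card {d\<in>?D. aprimedivisor d = p}) \<le> log p N" by simp
    moreover have "(\<Sum>d\<in>{d\<in>?D. aprimedivisor d = p}. ln (real (aprimedivisor d))) =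
          real (card {d\<in>?D. aprimedivisor d = p}) * ln p"
      by simp
    ultimately show "(\<Sum>d\<in>{d\<in>?D. aprimedivisor d = p}. ln (real (aprimedivisor d))) \<le> ln N"
      using p2 by (simp add: log_def field_simps)
  qed
  finally show ?thesis by simp
qed

text \<open>The difference \<open>2*n div d - 2 * (n div d)\<close> is at most \<open>1\<close>, so
  the quotient of factorials has logarithm at most the sum of \<open>mangoldt\<close> up to
  \<open>2*n\<close>.\<close>

lemma ln_central_binomial_le:
  assumes "n > 0"
  shows "ln (real ((2*n) choose n)) \<le> real (card (primes_upto (real (2*n)))) * ln (real (2*n))"
proof -
  have "real ((2*n) choose n) = fact (2*n) / (fact n * fact n)"
    by (simp add: binomial_fact)
  then have "ln (real ((2*n) choose n)) = ln (fact (2*n)) - 2 * ln (fact n)"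
    by (simp add: ln_div ln_mult)
  also have "\<dots> = (\<Sum>d=1..2*n. mangoldt d * (real (2*n div d) - 2 * real (n div d)))"
    using ln_fact_eq_sum_mangoldt[of "2*n" "2*n"] ln_fact_eq_sum_mangoldt[of n "2*n"]
    by (simp add: sum_subtractf right_diff_distrib sum_distrib_left mult.left_commute)
  also have "\<dots> \<le> (\<Sum>d=1..2*n. mangoldt d * 1)"
  proof (intro sum_mono mult_left_mono mangoldt_nonneg)
    fix d assume "d \<in> {1..2*n}"
    then have "d > 0" by simp
    have "n < (n div d + 1) * d" using \<open>d > 0\<close> dividend_less_div_times[of d n] by simp
    then have "2 * n < (2 * (n div d) + 2) * d" by (simp add: algebra_simps)
    then have "2 * n div d < 2 * (n div d) + 2"
      using \<open>d > 0\<close> by (simp add: div_less_iff_less_mult)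
    then show "real (2*n div d) - 2 * real (n div d) \<le> 1" by linarith
  qed
  also have "\<dots> \<le> real (card (primes_upto (real (2*n)))) * ln (real (2*n))"
    using sum_mangoldt_le[of "2*n"] assms by simp
  finally show ?thesis .
qed

text \<open>The bound \<open>4 ^ n / (2 * n)\<close> for the central binomial coefficient gives the
  order \<open>x / ln x\<close>; lowering the exponent to \<open>99/100\<close> absorbs the
  logarithm and all constants.\<close>

lemma eventually_card_primes_upto_ge:
  "eventually (\<lambda>x. real (card (primes_upto x)) \<ge> x powr (99/100)) at_top"
proof -
  have "eventually (\<lambda>x::real. ((x / 2 - 1) * ln 4 - ln x) / ln x \<ge> x powr (99/100)) at_top"
    by real_asymp
  then show ?thesis
    using eventually_ge_at_top[of 4]
  proof eventually_elim
    case (elim x)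
    define n where "n = nat \<lfloor>x / 2\<rfloor>"
    have n: "real n \<le> x / 2" "real n \<ge> x / 2 - 1" "n > 0"
      using elim unfolding n_def by linarith+
    have "4 ^ n / (2 * real n) \<le> real ((2*n) choose n)"
      using central_binomial_lower_bound[of n] n by simp
    then have "ln (4 ^ n / (2 * real n)) \<le> ln (real ((2*n) choose n))"
      using n by (subst ln_le_cancel_iff) (auto intro!: divide_pos_pos)
    also have "\<dots> \<le> real (card (primes_upto (real (2*n)))) * ln (real (2*n))"
      by (rule ln_central_binomial_le) (use n in simp)
    also have "\<dots> \<le> real (card (primes_upto x)) * ln x"
      using n elim by (intro mult_mono of_nat_mono card_mono primes_upto_mono) (auto)
    finally have "real n * ln 4 - ln (2 * real n) \<le> real (card (primes_upto x)) * ln x"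
      using n by (simp add: ln_div ln_realpow)
    moreover have "(x / 2 - 1) * ln 4 \<le> real n * ln 4" using n by (intro mult_right_mono) auto
    moreover have "ln (2 * real n) \<le> ln x" using n by simp
    ultimately have "(x / 2 - 1) * ln 4 - ln x \<le> real (card (primes_upto x)) * ln x" by linarith
    then have "((x / 2 - 1) * ln 4 - ln x) / ln x \<le> real (card (primes_upto x))"
      using elim by (simp add: field_simps)
    then show ?case using elim by linarith
  qed
qed


section \<open>Distances of prime multiples to the nearest integer\<close>

definition int_dist :: "real \<Rightarrow> real" where
  "int_dist x = \<bar>x - of_int (round x)\<bar>"

lemma int_dist_nonneg [simp]: "int_dist x \<ge> 0"
  by (simp add: int_dist_def)

lemma int_dist_le: "int_dist x \<le> \<bar>x - of_int k\<bar>"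
  unfolding int_dist_def by (rule round_diff_minimal)

lemma int_dist_le_half: "int_dist x \<le> 1/2"
  using of_int_round_abs_le[of x] by (simp add: int_dist_def abs_minus_commute)

lemma int_dist_eq:
  assumes "\<bar>x - of_int k\<bar> \<le> 1/2"
  shows "int_dist x = \<bar>x - of_int k\<bar>"
proof (cases "round x = k")
  case False
  then have "\<bar>of_int (round x) - of_int k :: real\<bar> \<ge> 1" by linarith
  then have "\<bar>x - of_int (round x)\<bar> \<ge> \<bar>x - of_int k\<bar>" using assms by linarith
  then show ?thesis using int_dist_le[of x k] by (simp add: int_dist_def)
qed (simp add: int_dist_def)

lemma int_dist_square_le_one_minus_cos: "(int_dist x)\<^sup>2 \<le> 1 - cos (2 * pi * x)"
proof -
  define y where "y = x - of_int (round x)"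
  define u where "u = 2 * pi * y"
  have y: "\<bar>y\<bar> \<le> 1/2" using int_dist_le_half[of x] by (simp add: int_dist_def y_def)
  have "cos (2 * pi * x) = cos (u + 2 * pi * of_int (round x))"
    by (simp add: u_def y_def algebra_simps)
  also have "\<dots> = cos u" by (simp add: cos_add sin_integer_2pi cos_integer_2pi)
  finally have cu: "cos (2 * pi * x) = cos u" .
  obtain t where "cos u = (\<Sum>m<4. cos_coeff m * u ^ m) + (cos (t + 1 / 2 * real 4 * pi) / fact 4) * u ^ 4"
    using Maclaurin_cos_expansion[of u 4] by auto
  then have "cos u = 1 - u\<^sup>2 / 2 + (cos (t + 2 * pi) / 24) * u ^ 4"
    by (simp add: lessThan_nat_numeral lessThan_Suc cos_coeff_def fact_numeral)
  also have "\<dots> \<le> 1 - u\<^sup>2 / 2 + 1 / 24 * u ^ 4"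
    by (intro add_left_mono mult_right_mono) auto
  also have "u ^ 4 = u\<^sup>2 * u\<^sup>2" by (simp add: eval_nat_numeral)
  finally have 1: "1 - cos u \<ge> u\<^sup>2 * (1 / 2 - u\<^sup>2 / 24)" by (simp add: algebra_simps)
  \<comment> \<open>\<open>16/5\<close> lies above \<open>pi\<close> and is small enough that
    \<open>1/2 - u^2 / 24\<close> stays above \<open>1/24\<close> for
    \<open>\<bar>u\<bar> \<le> 16/5\<close>.\<close>
  have pi_lt: "pi < 16/5" using pi_approx by simp
  have "\<bar>u\<bar> = 2 * pi * \<bar>y\<bar>" by (simp add: u_def abs_mult)
  also have "\<dots> \<le> 2 * pi * (1/2)" using y by (intro mult_left_mono) auto
  also have "\<dots> < 16/5" using pi_lt by simp
  finally have "\<bar>u\<bar>\<^sup>2 \<le> (16/5)\<^sup>2" by (intro power_mono) auto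
  then have "1 / 2 - u\<^sup>2 / 24 \<ge> 1 / 24" by (simp add: power2_eq_square)
  then have "u\<^sup>2 * (1 / 2 - u\<^sup>2 / 24) \<ge> u\<^sup>2 * (1/24)" by (intro mult_left_mono) auto
  moreover have "u\<^sup>2 = 4 * pi\<^sup>2 * y\<^sup>2" by (simp add: u_def power_mult_distrib)
  moreover have "pi\<^sup>2 \<ge> 3\<^sup>2" using pi_gt3 by (intro power_mono) auto
  then have "4 * pi\<^sup>2 * y\<^sup>2 \<ge> 24 * y\<^sup>2" by (intro mult_right_mono) auto
  moreover have "(int_dist x)\<^sup>2 = y\<^sup>2" by (simp add: int_dist_def y_def)
  ultimately show ?thesis using 1 unfolding cu by linarith
qed

text \<open>At most \<open>M = y powr (99/100) / 2\<close> primes lie below \<open>M\<close>, so at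
  least \<open>M\<close> of the primes up to \<open>y\<close> exceed it, and each of these
  contributes at least \<open>M ^ k\<close>.\<close>

lemma sum_prime_powers_ge:
  assumes "y > 0" and card: "real (card (primes_upto y)) \<ge> y powr (99/100)"
  shows "(\<Sum>p\<in>primes_upto y. real p ^ k) \<ge> (y powr (99/100) / 2) ^ Suc k"
proof -
  define M where "M = y powr (99/100) / 2"
  have M: "M \<ge> 0" by (simp add: M_def)
  have "primes_upto M \<subseteq> {1..nat \<lfloor>M\<rfloor>}"
    by (auto simp: primes_upto_def le_nat_floor prime_gt_0_nat Suc_le_eq)
  then have "card (primes_upto M) \<le> nat \<lfloor>M\<rfloor>"
    using card_mono[of "{1..nat \<lfloor>M\<rfloor>}" "primes_upto M"] by simp
  then have "real (card (primes_upto M)) \<le> M" using M by linarith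
  moreover have "card (primes_upto y) - card (primes_upto M) \<le> card (primes_upto y - primes_upto M)"
    by (rule diff_card_le_card_Diff) simp
  ultimately have cd: "real (card (primes_upto y - primes_upto M)) \<ge> M"
    using card unfolding M_def by linarith
  have "M ^ Suc k \<le> real (card (primes_upto y - primes_upto M)) * M ^ k"
    using cd M by (simp add: mult_right_mono)
  also have "\<dots> = (\<Sum>p\<in>primes_upto y - primes_upto M. M ^ k)" by simp
  also have "\<dots> \<le> (\<Sum>p\<in>primes_upto y - primes_upto M. real p ^ k)"
    using M by (intro sum_mono power_mono) (auto simp: primes_upto_def)
  also have "\<dots> \<le> (\<Sum>p\<in>primes_upto y. real p ^ k)"
    by (intro sum_mono2) auto
  finally show ?thesis by (simp add: M_def)
qed

text \<open>Within a block of at most \<open>k/2 + 1\<close> consecutive integers the points \<open>n * \<alpha>\<close> are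
  \<open>1/(2k)\<close>-separated modulo 1.\<close>

lemma card_int_dist_less:
  fixes \<alpha> \<eta> x :: real and h k :: int and N :: nat
  assumes cop: "coprime h k" and k: "0 < k" "k \<le> int N" and approx: "\<bar>of_int k * \<alpha> - of_int h\<bar> < 1 / N"
    and \<eta>: "\<eta> > 0" and x: "x \<ge> 0"
  shows "real (card {n::nat. real n \<le> x \<and> int_dist (real n * \<alpha>) < \<eta>})
           \<le> (2 * x / of_int k + 1) * (4 * \<eta> * of_int k + 1)"
proof -
  define B where "B = {n::nat. real n \<le> x \<and> int_dist (real n * \<alpha>) < \<eta>}"
  define f where "f n = real n * \<alpha> - of_int (round (real n * \<alpha>))" for n :: nat
  \<comment> \<open>Block length: indices in one block differ by some
    \<open>d \<le> k div 2\<close>, so \<open>d\<close> times the approximation error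
    \<open>1 / N\<close> is at most \<open>1/2\<close>.\<close>
  define L where "L = nat k div 2 + 1"
  \<comment> \<open>The block of \<open>n\<close>, and the cell of width \<open>1 / (2 * k)\<close>
    containing the signed residue of \<open>n * \<alpha>\<close>, shifted by \<open>\<eta>\<close>
    to be nonnegative on \<open>B\<close>. Separation makes \<open>g\<close> injective on
    \<open>B\<close>, so counting pairs bounds \<open>card B\<close>.\<close>
  define g where "g n = (n div L, nat \<lfloor>(f n + \<eta>) * (2 * of_int k)\<rfloor>)" for n
  have N: "N > 0" using k by simp
  have L: "L > 0" "real L \<ge> of_int k / 2" using k unfolding L_def by linarith+
  have f: "\<bar>f n\<bar> < \<eta>" if "n \<in> B" for n using that by (simp add: B_def f_def int_dist_def)
  have sep: "of_int k * \<bar>f n - f m\<bar> \<ge> 1/2" if nm: "m < n" "n div L = m div L" for m n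
  proof -
    define d where "d = n - m"
    have "n mod L < L" "m mod L < L" using L by auto
    then have "d < L" using nm div_mult_mod_eq[of n L] div_mult_mod_eq[of m L] unfolding d_def
      by (metis add_diff_cancel_left less_imp_diff_less)
    then have d: "0 < d" "2 * int d \<le> k" using nm k by (auto simp: d_def L_def)
    define j where "j = round (real n * \<alpha>) - round (real m * \<alpha>)"
    have fd: "f n - f m = real d * \<alpha> - of_int j"
      using nm by (simp add: f_def d_def j_def of_nat_diff algebra_simps)
    \<comment> \<open>Since \<open>k\<close> is coprime to \<open>h\<close> and exceeds
      \<open>d\<close>, the integer \<open>d * h - j * k\<close> is nonzero and outweighs the
      approximation error.\<close>
    have "\<not> k dvd int d * h"
    proof
      assume "k dvd int d * h"
      then have "k dvd int d" using cop by (simp add: coprime_dvd_mult_left_iff coprime_commute)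
      then have "k \<le> int d" using d by (intro zdvd_imp_le) auto
      then show False using d k by linarith
    qed
    then have "int d * h - j * k \<noteq> 0" by (metis dvd_triv_right eq_iff_diff_eq_0)
    then have "\<bar>int d * h - j * k\<bar> \<ge> 1" by linarith
    then have 1: "\<bar>of_int (int d * h - j * k) :: real\<bar> \<ge> 1" by linarith
    have "real d * \<bar>of_int k * \<alpha> - of_int h\<bar> \<le> real d * (1 / N)"
      using approx by (intro mult_left_mono) auto
    also have "\<dots> \<le> 1/2"
    proof -
      have "2 * real d \<le> real N" using d k by linarith
      then show ?thesis using N by (simp add: field_simps)
    qed
    finally have 2: "\<bar>real d * (of_int k * \<alpha> - of_int h)\<bar> \<le> 1/2" by (simp add: abs_mult)
    have "of_int k * \<bar>f n - f m\<bar> = \<bar>of_int k * (f n - f m)\<bar>" using k by (simp add: abs_mult)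
    also have "of_int k * (f n - f m) = real d * (of_int k * \<alpha> - of_int h) + of_int (int d * h - j * k)"
      unfolding fd by (simp add: algebra_simps)
    finally show ?thesis using 1 2 by linarith
  qed
  have "inj_on g B"
  proof (rule linorder_inj_onI)
    fix m n assume mn: "m < n" "m \<in> B" "n \<in> B"
    show "g m \<noteq> g n"
    proof
      assume eq: "g m = g n"
      have pos: "(f i + \<eta>) * (2 * of_int k) \<ge> 0" if "i \<in> B" for i
        using f[OF that] k by (intro mult_nonneg_nonneg) auto
      have "nat \<lfloor>(f n + \<eta>) * (2 * of_int k)\<rfloor> = nat \<lfloor>(f m + \<eta>) * (2 * of_int k)\<rfloor>"
        using eq by (simp add: g_def)
      then have "\<lfloor>(f n + \<eta>) * (2 * of_int k)\<rfloor> = \<lfloor>(f m + \<eta>) * (2 * of_int k)\<rfloor>"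
        using pos[of n] pos[of m] mn by (simp add: nat_eq_iff2)
      then have "\<bar>(f n + \<eta>) * (2 * of_int k) - (f m + \<eta>) * (2 * of_int k)\<bar> < 1"
        by linarith
      also have "(f n + \<eta>) * (2 * of_int k) - (f m + \<eta>) * (2 * of_int k) = 2 * of_int k * (f n - f m)"
        by (simp add: algebra_simps)
      finally have "of_int k * \<bar>f n - f m\<bar> < 1/2" using k by (simp add: abs_mult)
      then show False using sep[of m n] mn eq by (simp add: g_def)
    qed
  qed auto
  moreover have "g ` B \<subseteq> {..nat \<lfloor>2 * x / of_int k\<rfloor>} \<times> {..nat \<lfloor>4 * \<eta> * of_int k\<rfloor>}"
  proof
    fix y assume "y \<in> g ` B"
    then obtain n where n: "n \<in> B" "y = g n" by auto
    have "real (n div L) \<le> real n / real L" by (rule of_nat_div_le_of_nat)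
    also have "\<dots> \<le> x / (of_int k / 2)"
      using n L k x by (intro frac_le) (auto simp: B_def)
    finally have 1: "n div L \<le> nat \<lfloor>2 * x / of_int k\<rfloor>"
      by (intro le_nat_floor) (simp add: mult.commute)
    have "(f n + \<eta>) * (2 * of_int k) \<le> (2 * \<eta>) * (2 * of_int k)"
      using f[OF n(1)] k by (intro mult_right_mono) auto
    then have "nat \<lfloor>(f n + \<eta>) * (2 * of_int k)\<rfloor> \<le> nat \<lfloor>4 * \<eta> * of_int k\<rfloor>"
      by (intro nat_mono floor_mono) (simp add: algebra_simps)
    with 1 show "y \<in> {..nat \<lfloor>2 * x / of_int k\<rfloor>} \<times> {..nat \<lfloor>4 * \<eta> * of_int k\<rfloor>}"
      by (simp add: n g_def)
  qed
  ultimately have "card B \<le> card ({..nat \<lfloor>2 * x / of_int k\<rfloor>} \<times> {..nat \<lfloor>4 * \<eta> * of_int k\<rfloor>})"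
    by (intro card_inj_on_le[of g]) auto
  then have "card B \<le> (nat \<lfloor>2 * x / of_int k\<rfloor> + 1) * (nat \<lfloor>4 * \<eta> * of_int k\<rfloor> + 1)"
    by (simp add: card_cartesian_product)
  then have "real (card B) \<le> real ((nat \<lfloor>2 * x / of_int k\<rfloor> + 1) * (nat \<lfloor>4 * \<eta> * of_int k\<rfloor> + 1))"
    by (rule of_nat_mono)
  also have "\<dots> = (real (nat \<lfloor>2 * x / of_int k\<rfloor>) + 1) * (real (nat \<lfloor>4 * \<eta> * of_int k\<rfloor>) + 1)"
    by (simp add: algebra_simps)
  also have "\<dots> \<le> (2 * x / of_int k + 1) * (4 * \<eta> * of_int k + 1)"
    using x \<eta> k by (intro mult_mono add_mono of_nat_floor order.refl) (auto intro!: add_nonneg_nonneg)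
  finally show ?thesis by (simp add: B_def)
qed

text \<open>Dirichlet approximation uses denominators up to about \<open>sqrt x\<close>. Write
  \<beta> for the distance of \<alpha> to the integers. For small \<beta> the sum is of order at
  least \<open>x powr (297/100) * \<beta>^2\<close>, or, once multiples may wrap around,
  \<open>x powr (97/200)\<close>. Denominators from \<open>2\<close> to \<open>x powr (1/10)\<close>
  give \<open>x powr (59/200)\<close>, larger ones \<open>x powr (89/100)\<close>. The exponents
  \<open>29/10\<close> and \<open>1/5\<close> leave room for the constants in every case.\<close>

lemma eventually_sum_int_dist_primes_ge:
  "eventually (\<lambda>x. \<forall>\<alpha>. (\<Sum>p\<in>primes_upto x. (int_dist (real p * \<alpha>))\<^sup>2)
       \<ge> min (x powr (29/10) * (int_dist \<alpha>)\<^sup>2) (x powr (1/5))) at_top"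
proof -
  obtain X0 where X0: "\<And>y. y \<ge> X0 \<Longrightarrow> real (card (primes_upto y)) \<ge> y powr (99/100)"
    using eventually_card_primes_upto_ge unfolding eventually_at_top_linorder by blast
  have "eventually (\<lambda>x::real. (sqrt x - 1) / 2 \<ge> X0) at_top" by real_asymp
  moreover have "eventually (\<lambda>x::real. (x powr (99/100) / 2) ^ 3 \<ge> x powr (29/10)) at_top" by real_asymp
  moreover have "eventually (\<lambda>x::real. ((sqrt x - 1) / 2) powr (97/100) / 32 \<ge> x powr (1/5)) at_top" by real_asymp
  moreover have "eventually (\<lambda>x::real. (((sqrt x - 1) / 2) powr (99/100) - x powr (1/10)) * (x powr (-1/10) / 2)\<^sup>2
       \<ge> x powr (1/5)) at_top" by real_asymp
  moreover have "eventually (\<lambda>x::real. (x powr (99/100) - 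
       (8 * x powr (-1/20) * x + 2 * x / x powr (1/10) + 4 * x powr (-1/20) * sqrt x + 1)) * (x powr (-1/20))\<^sup>2
       \<ge> x powr (1/5)) at_top" by real_asymp
  ultimately show ?thesis
    using eventually_ge_at_top[of "max X0 16"]
  proof eventually_elim
    case (elim x)
    note e = elim
    show ?case
    proof
      fix \<alpha>
      define \<beta> where "\<beta> = int_dist \<alpha>"
      define N where "N = nat \<lfloor>sqrt x\<rfloor>"
      have "sqrt x \<ge> sqrt 16" using e by (intro real_sqrt_le_mono) auto
      then have sq: "sqrt x \<ge> 4" by simp
      have N: "real N \<le> sqrt x" "real N \<ge> sqrt x - 1" "N \<ge> 3" using sq unfolding N_def by linarith+
      have x: "x \<ge> 16" "x \<ge> X0" using e by auto
      have "sqrt x * 1 \<le> sqrt x * sqrt x" using sq x by (intro mult_left_mono) auto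
      then have sqx: "sqrt x \<le> x" using x by simp
      let ?S = "\<lambda>x. \<Sum>p\<in>primes_upto x. (int_dist (real p * \<alpha>))\<^sup>2"
      have S_mono: "?S y \<le> ?S x" if "y \<le> x" for y
        using that by (intro sum_mono2 primes_upto_mono) auto
      consider "\<beta> = 0" | "\<beta> > 0" "\<beta> \<le> 1 / N" | "\<beta> > 1 / N"
        using int_dist_nonneg[of \<alpha>] unfolding \<beta>_def by linarith
      then have "?S x \<ge> min (x powr (29/10) * \<beta>\<^sup>2) (x powr (1/5))"
      proof cases
        case 1
        then show ?thesis by (simp add: min_def sum_nonneg)
      next
        case 2
        \<comment> \<open>Up to \<open>1 / (2 * \<beta>)\<close> the multiples of \<alpha> have not
          moved past half the way to another integer, so the distance grows linearly in
          \<open>p\<close>.\<close>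
        define Y where "Y = min x (1 / (2 * \<beta>))"
        have "real N / 2 \<le> 1 / (2 * \<beta>)" using 2 N by (simp add: field_simps)
        then have YN: "Y \<ge> real N / 2" using N sqx by (auto simp: Y_def)
        then have Y: "Y \<ge> X0" "Y \<le> x" "Y > 0" "Y \<ge> (sqrt x - 1) / 2" using N e 2 by (auto simp: Y_def)
        have eq: "int_dist (real p * \<alpha>) = real p * \<beta>" if "p \<in> primes_upto Y" for p
        proof -
          have "real p \<le> 1 / (2 * \<beta>)" using that by (auto simp: primes_upto_def Y_def)
          then have le: "real p * \<beta> \<le> 1/2" using 2 by (simp add: field_simps)
          have ab: "\<bar>real p * \<alpha> - of_int (int p * round \<alpha>)\<bar> = real p * \<beta>"
          proof -
            have "real p * \<alpha> - of_int (int p * round \<alpha>) = real p * (\<alpha> - of_int (round \<alpha>))"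
              by (simp add: algebra_simps)
            then show ?thesis by (simp add: \<beta>_def int_dist_def abs_mult)
          qed
          then show ?thesis using le int_dist_eq[of "real p * \<alpha>" "int p * round \<alpha>"] by simp
        qed
        have "(Y powr (99/100) / 2) ^ 3 * \<beta>\<^sup>2 \<le> (\<Sum>p\<in>primes_upto Y. real p ^ 2) * \<beta>\<^sup>2"
          using sum_prime_powers_ge[OF Y(3) X0[OF Y(1)], of 2]
          by (intro mult_right_mono) (auto simp: eval_nat_numeral)
        also have "\<dots> = ?S Y"
          using eq by (simp add: sum_distrib_right power_mult_distrib)
        also have "\<dots> \<le> ?S x" by (rule S_mono) (use Y in simp)
        finally have main: "(Y powr (99/100) / 2) ^ 3 * \<beta>\<^sup>2 \<le> ?S x" .
        show ?thesis
        proof (cases "Y = x")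
          case True
          have "x powr (29/10) * \<beta>\<^sup>2 \<le> (x powr (99/100) / 2) ^ 3 * \<beta>\<^sup>2"
            using e by (intro mult_right_mono) auto
          then show ?thesis using main True by simp
        next
          case False
          then have "Y = 1 / (2 * \<beta>)" by (auto simp: Y_def min_def split: if_splits)
          then have b: "\<beta> = 1 / (2 * Y)" by simp
          have "x powr (1/5) \<le> ((sqrt x - 1) / 2) powr (97/100) / 32" using e by simp
          also have "\<dots> \<le> Y powr (97/100) / 32"
            using Y sq by (intro divide_right_mono powr_mono2) auto
          also have "\<dots> = (Y powr (99/100) / 2) ^ 3 * \<beta>\<^sup>2"
          proof -
            have "(Y powr (99/100)) ^ 3 = Y powr (297/100)" using Y by (simp add: powr_power)
            also have "\<dots> = Y powr (97/100 + 2)" by simp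
            also have "\<dots> = Y powr (97/100) * Y\<^sup>2" using Y by (subst powr_add) (simp add: powr_numeral)
            finally show ?thesis using Y by (simp add: b power_divide power_mult_distrib)
          qed
          finally show ?thesis using main by simp
        qed
      next
        case 3
        have "N > 0" using N by simp
        from Dirichlet_approx_coprime[OF this, of \<alpha>] obtain h k where hk:
          "coprime h k" "0 < k" "k \<le> int N" "\<bar>of_int k * \<alpha> - of_int h\<bar> < 1/N" by blast
        \<comment> \<open>Denominator \<open>1\<close> would put \<alpha> within
          \<open>1 / N\<close> of an integer, which belongs to the previous cases.\<close>
        have "k \<noteq> 1"
        proof
          assume "k = 1"
          then have "\<beta> < 1 / N" using hk int_dist_le[of \<alpha> h] by (simp add: \<beta>_def)
          then show False using 3 by simp
        qed
        then have k2: "k \<ge> 2" using hk by simp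
        show ?thesis
        proof (cases "of_int k \<le> x powr (1/10)")
          case True
          \<comment> \<open>A prime \<open>p > k\<close> is not divisible by
            \<open>k \<ge> 2\<close>, and \<open>p \<le> N / 2\<close> keeps \<open>p\<close> times
            the approximation error at most \<open>1/2\<close>; together they give a distance of at
            least \<open>1 / (2 * k)\<close>.\<close>
          define A where "A = primes_upto (real N / 2) - {1..nat k}"
          have dist: "int_dist (real p * \<alpha>) \<ge> x powr (-1/10) / 2" if "p \<in> A" for p
          proof -
            have p: "prime p" "real p \<le> real N / 2" "int p > k" 
              using that hk by (auto simp: A_def primes_upto_def prime_gt_0_nat Suc_le_eq)
            define m where "m = round (real p * \<alpha>)"
            have "\<not> k dvd int p * h"
            proof
              assume "k dvd int p * h"
              then have "k dvd int p" using hk(1) by (simp add: coprime_dvd_mult_left_iff coprime_commute)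
              moreover have "prime (int p)" using p by simp
              ultimately have "k = 1 \<or> k = int p" using hk(2) by (meson less_imp_le prime_int_iff)
              then show False using k2 p by auto
            qed
            then have "int p * h - m * k \<noteq> 0" by (metis dvd_triv_right eq_iff_diff_eq_0)
            then have "\<bar>int p * h - m * k\<bar> \<ge> 1" by linarith
            then have 1: "\<bar>of_int (int p * h - m * k) :: real\<bar> \<ge> 1" by linarith
            have "real p * \<bar>of_int k * \<alpha> - of_int h\<bar> \<le> (real N / 2) * (1 / N)"
              using hk p by (intro mult_mono) auto
            also have "\<dots> = 1/2" using N by simp
            finally have 2: "\<bar>real p * (of_int k * \<alpha> - of_int h)\<bar> \<le> 1/2" by (simp add: abs_mult)
            have "of_int k * int_dist (real p * \<alpha>) = \<bar>of_int k * (real p * \<alpha> - of_int m)\<bar>"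
              using hk by (simp add: int_dist_def m_def abs_mult)
            also have "of_int k * (real p * \<alpha> - of_int m) = 
                real p * (of_int k * \<alpha> - of_int h) + of_int (int p * h - m * k)"
              by (simp add: algebra_simps)
            finally have "of_int k * int_dist (real p * \<alpha>) \<ge> 1/2" using 1 2 by linarith
            also have "of_int k * int_dist (real p * \<alpha>) \<le> x powr (1/10) * int_dist (real p * \<alpha>)"
              using True by (intro mult_right_mono) auto
            finally have "1/2 / x powr (1/10) \<le> int_dist (real p * \<alpha>)"
              using x by (subst pos_divide_le_eq) (auto simp: mult.commute)
            then show ?thesis using x by (simp add: powr_minus_divide)
          qed
          have "card (primes_upto (real N / 2)) - card {1..nat k} \<le> card A"
            unfolding A_def by (rule diff_card_le_card_Diff) simp
          then have "real (card A) \<ge> real (card (primes_upto (real N / 2))) - of_int k" using hk by simp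
          moreover have "real (card (primes_upto (real N / 2))) \<ge> (real N / 2) powr (99/100)"
            using N e by (intro X0) auto
          moreover have "(real N / 2) powr (99/100) \<ge> ((sqrt x - 1) / 2) powr (99/100)"
            using N sq x by (intro powr_mono2) auto
          ultimately have cA: "real (card A) \<ge> ((sqrt x - 1) / 2) powr (99/100) - x powr (1/10)"
            using True by linarith
          have "x powr (1/5) \<le> (((sqrt x - 1) / 2) powr (99/100) - x powr (1/10)) * (x powr (-1/10) / 2)\<^sup>2"
            using e by simp
          also have "\<dots> \<le> real (card A) * (x powr (-1/10) / 2)\<^sup>2"
            using cA by (intro mult_right_mono) auto
          also have "\<dots> = (\<Sum>p\<in>A. (x powr (-1/10) / 2)\<^sup>2)" by simp
          also have "\<dots> \<le> (\<Sum>p\<in>A. (int_dist (real p * \<alpha>))\<^sup>2)"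
            using dist by (intro sum_mono power_mono) auto
          also have "\<dots> \<le> ?S (real N / 2)"
            by (intro sum_mono2) (auto simp: A_def)
          also have "\<dots> \<le> ?S x" using N sqx by (intro S_mono) auto
          finally show ?thesis by simp
        next
          case False
          \<comment> \<open>With this \<open>\<eta>\<close> and \<open>k > x powr (1/10)\<close>, at
            most about \<open>x powr (19/20)\<close> integers are close, fewer than the
            \<open>x powr (99/100)\<close> primes.\<close>
          define \<eta> where "\<eta> = x powr (-1/20)"
          define B where "B = {n::nat. real n \<le> x \<and> int_dist (real n * \<alpha>) < \<eta>}"
          have \<eta>: "\<eta> > 0" using x by (simp add: \<eta>_def)
          have finB: "finite B"
            by (rule finite_subset[of _ "{..nat \<lfloor>x\<rfloor>}"]) (auto simp: B_def le_nat_floor)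
          have kN: "of_int k \<le> sqrt x" using hk N by linarith
          have "real (card B) \<le> (2 * x / of_int k + 1) * (4 * \<eta> * of_int k + 1)"
            unfolding B_def using hk \<eta> x by (intro card_int_dist_less) auto
          also have "\<dots> = 8 * \<eta> * x + 2 * x / of_int k + 4 * \<eta> * of_int k + 1"
            using hk by (simp add: field_simps)
          also have "\<dots> \<le> 8 * \<eta> * x + 2 * x / x powr (1/10) + 4 * \<eta> * sqrt x + 1"
            using False x kN \<eta> hk by (intro add_mono divide_left_mono mult_left_mono mult_pos_pos) auto
          finally have cB: "real (card B) \<le> 8 * \<eta> * x + 2 * x / x powr (1/10) + 4 * \<eta> * sqrt x + 1" .
          have "card (primes_upto x) - card B \<le> card (primes_upto x - B)"
            by (rule diff_card_le_card_Diff) (rule finB)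
          then have cA: "real (card (primes_upto x - B)) \<ge> x powr (99/100) - 
              (8 * \<eta> * x + 2 * x / x powr (1/10) + 4 * \<eta> * sqrt x + 1)"
            using cB X0[OF x(2)] by linarith
          have "x powr (1/5) \<le> (x powr (99/100) - 
              (8 * \<eta> * x + 2 * x / x powr (1/10) + 4 * \<eta> * sqrt x + 1)) * \<eta>\<^sup>2"
            using e by (simp add: \<eta>_def)
          also have "\<dots> \<le> real (card (primes_upto x - B)) * \<eta>\<^sup>2"
            using cA by (intro mult_right_mono) auto
          also have "\<dots> = (\<Sum>p\<in>primes_upto x - B. \<eta>\<^sup>2)" by simp
          also have "\<dots> \<le> (\<Sum>p\<in>primes_upto x - B. (int_dist (real p * \<alpha>))\<^sup>2)"
            using \<eta> by (intro sum_mono power_mono) (auto simp: B_def primes_upto_def)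
          also have "\<dots> \<le> ?S x" by (intro sum_mono2) auto
          finally show ?thesis by simp
        qed
      qed
      then show "?S x \<ge> min (x powr (29/10) * (int_dist \<alpha>)\<^sup>2) (x powr (1/5))"
        by (simp add: \<beta>_def)
    qed
  qed
qed

text \<open>A single \<open>s\<close> would not do in the locale below: \<open>s * \<alpha>\<close> may be an integer although \<open>\<alpha>\<close> is not.\<close>

lemma int_dist_two_multiples_ge:
  fixes s s' :: nat
  assumes "coprime s s'"
  shows "\<exists>\<kappa>>0. \<forall>\<alpha>. int_dist (real s * \<alpha>) \<ge> \<kappa> * int_dist \<alpha> \<or> int_dist (real s' * \<alpha>) \<ge> \<kappa> * int_dist \<alpha>"
proof -
  obtain u v where uv: "u * int s + v * int s' = 1"
    using bezout_int[of "int s" "int s'"] assms by (auto simp: coprime_iff_gcd_eq_1 gcd_int_int_eq)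
  \<comment> \<open>By Bezout, \<open>\<alpha> = u * (s * \<alpha>) + v * (s' * \<alpha>)\<close>.
    If both distances were below \<open>\<kappa> * int_dist \<alpha>\<close>, then
    \<open>int_dist \<alpha>\<close> would be smaller than itself.\<close>
  define \<kappa> where "\<kappa> = 1 / (\<bar>of_int u\<bar> + \<bar>of_int v\<bar> :: real)"
  have "u \<noteq> 0 \<or> v \<noteq> 0" using uv by auto
  then have pos: "\<bar>of_int u\<bar> + \<bar>of_int v\<bar> > (0::real)" by auto
  have "int_dist (real s * \<alpha>) \<ge> \<kappa> * int_dist \<alpha> \<or> int_dist (real s' * \<alpha>) \<ge> \<kappa> * int_dist \<alpha>" for \<alpha>
  proof (rule ccontr)
    assume "\<not> ?thesis"
    then have lt: "int_dist (real s * \<alpha>) < \<kappa> * int_dist \<alpha>" "int_dist (real s' * \<alpha>) < \<kappa> * int_dist \<alpha>"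
      by auto
    let ?m = "round (real s * \<alpha>)" and ?m' = "round (real s' * \<alpha>)"
    have "1 = (of_int u * real s + of_int v * real s' :: real)"
      using arg_cong[OF uv, of real_of_int] by simp
    then have "\<alpha> = of_int u * (real s * \<alpha>) + of_int v * (real s' * \<alpha>)"
      by (metis distrib_right mult.assoc mult_1)
    then have "\<alpha> - of_int (u * ?m + v * ?m') = 
       of_int u * (real s * \<alpha> - of_int ?m) + of_int v * (real s' * \<alpha> - of_int ?m')"
      by (simp add: algebra_simps)
    then have "int_dist \<alpha> \<le> \<bar>of_int u * (real s * \<alpha> - of_int ?m) + of_int v * (real s' * \<alpha> - of_int ?m')\<bar>"
      using int_dist_le[of \<alpha> "u * ?m + v * ?m'"] by simp
    also have "\<dots> \<le> \<bar>of_int u\<bar> * int_dist (real s * \<alpha>) + \<bar>of_int v\<bar> * int_dist (real s' * \<alpha>)"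
      by (rule order.trans[OF abs_triangle_ineq]) (simp add: abs_mult int_dist_def)
    also have "\<dots> < (\<bar>of_int u\<bar> + \<bar>of_int v\<bar>) * (\<kappa> * int_dist \<alpha>)"
    proof (cases "u = 0")
      case True
      then have "v \<noteq> 0" using uv by auto
      then show ?thesis using True lt by (simp add: mult_strict_left_mono)
    next
      case False
      then show ?thesis unfolding distrib_right
        using lt by (intro add_less_le_mono mult_strict_left_mono mult_left_mono) auto
    qed
    also have "\<dots> = int_dist \<alpha>" using pos by (simp add: \<kappa>_def)
    finally show False by simp
  qed
  moreover have "\<kappa> > 0" using pos by (simp add: \<kappa>_def)
  ultimately show ?thesis by blast
qed

section \<open>The saddle point integral\<close>

lemma has_integral_gaussian:
  fixes \<sigma> :: real
  assumes "\<sigma> > 0"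
  shows "((\<lambda>x. exp (- x\<^sup>2 / (2 * \<sigma>\<^sup>2))) has_integral sqrt (2 * pi * \<sigma>\<^sup>2)) UNIV"
    and "((\<lambda>x. \<bar>x\<bar> ^ 3 * exp (- x\<^sup>2 / (2 * \<sigma>\<^sup>2))) has_integral 4 * \<sigma> ^ 4) UNIV"
proof -
  let ?s = "sqrt (2 * pi * \<sigma>\<^sup>2)"
  have hb: "(f has_integral I) UNIV" if "has_bochner_integral lborel f I" for f :: "real \<Rightarrow> real" and I
    using that has_integral_integral_lborel[of f] by (auto simp: has_bochner_integral_iff)
  have s: "?s > 0" using assms by simp
  have "((\<lambda>x. normal_density 0 \<sigma> x) has_integral 1) UNIV"
    using hb[OF normal_moment_even[OF assms, of 0 0]] by simp
  from has_integral_mult_right[OF this, of ?s] s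
  show "((\<lambda>x. exp (- x\<^sup>2 / (2 * \<sigma>\<^sup>2))) has_integral ?s) UNIV"
    using assms by (simp add: normal_density_def)
  have "((\<lambda>x. normal_density 0 \<sigma> x * \<bar>x - 0\<bar> ^ (2 * 1 + 1)) has_integral 
          2 ^ 1 * \<sigma> ^ (2 * 1 + 1) * fact 1 * sqrt (2 / pi)) UNIV"
    using hb[OF normal_moment_abs_odd[OF assms, of 0 1]] .
  from has_integral_mult_right[OF this, of ?s]
  have "((\<lambda>x. ?s * (normal_density 0 \<sigma> x * \<bar>x\<bar> ^ 3)) has_integral ?s * (2 * \<sigma> ^ 3 * sqrt (2 / pi))) UNIV"
    by (simp add: eval_nat_numeral)
  also have "(\<lambda>x. ?s * (normal_density 0 \<sigma> x * \<bar>x\<bar> ^ 3)) = (\<lambda>x. \<bar>x\<bar> ^ 3 * exp (- x\<^sup>2 / (2 * \<sigma>\<^sup>2)))"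
    using s assms by (simp add: normal_density_def fun_eq_iff)
  also have "?s * (2 * \<sigma> ^ 3 * sqrt (2 / pi)) = 4 * \<sigma> ^ 4"
  proof -
    have "?s * sqrt (2 / pi) = sqrt ((2 * \<sigma>)\<^sup>2)"
      by (subst real_sqrt_mult [symmetric]) (simp add: power2_eq_square)
    also have "\<dots> = 2 * \<sigma>" using assms by (subst real_sqrt_abs) simp
    finally have "2 * \<sigma> ^ 3 * (?s * sqrt (2 / pi)) = 2 * \<sigma> ^ 3 * (2 * \<sigma>)" by (rule arg_cong)
    then show ?thesis by (simp add: eval_nat_numeral mult_ac)
  qed
  finally show "((\<lambda>x. \<bar>x\<bar> ^ 3 * exp (- x\<^sup>2 / (2 * \<sigma>\<^sup>2))) has_integral 4 * \<sigma> ^ 4) UNIV" .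
qed

lemma norm_exp_diff_le:
  fixes u v :: complex
  assumes "Re u \<le> M" "Re v \<le> M"
  shows "norm (exp u - exp v) \<le> exp M * norm (u - v)"
proof (rule field_differentiable_bound[where S = "{z. Re z \<le> M}" and f = exp and f' = exp and B = "exp M"])
  show "convex {z. Re z \<le> M}" by (rule convex_halfspace_Re_le)
qed (use assms in \<open>auto intro!: derivative_eq_intros\<close>)

text \<open>A single pointwise bound on the whole line does all the work. At
  \<open>\<bar>x\<bar> = 3 * A / (2 * B)\<close> the cubic error reaches half of
  \<open>A * x^2 / 2\<close>, so up to there both exponentials are at most
  \<open>exp (- (A * x^2 / 4))\<close>. The cube of \<open>2 * B / (3 * A)\<close> comes from the
  Gaussian tail: beyond the cutoff, the cube of \<open>\<bar>x\<bar>\<close> over the cutoff is at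
  least \<open>1\<close>, which turns the tail into the same integrand as the cubic error.\<close>

lemma saddle_integral_estimate:
  fixes h :: "real \<Rightarrow> complex" and A B M :: real
  assumes cont: "continuous_on {-pi..pi} h" and A: "A > 0" and AB: "A \<le> B"
    and taylor: "\<And>x. \<bar>x\<bar> \<le> pi \<Longrightarrow> norm (h x + of_real (A * x\<^sup>2 / 2)) \<le> B * \<bar>x\<bar> ^ 3 / 6"
    and minor: "\<And>x. \<bar>x\<bar> \<le> pi \<Longrightarrow> \<bar>x\<bar> > 3 * A / (2 * B) \<Longrightarrow> Re (h x) \<le> - M"
  shows "norm (integral {-pi..pi} (\<lambda>x. exp (h x)) - of_real (sqrt (2 * pi / A)))
           \<le> (B / 6 + (2 * B / (3 * A)) ^ 3) * (16 / A\<^sup>2) + 2 * pi * exp (- M)"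
proof -
  define \<tau> where "\<tau> = 3 * A / (2 * B)"
  have B: "B > 0" using A AB by simp
  \<comment> \<open>\<open>A \<le> B\<close> keeps the cutoff below \<open>pi\<close>, so the inner
    range lies inside the interval of integration.\<close>
  have \<tau>: "\<tau> > 0" "\<tau> \<le> 3/2" using A AB B by (auto simp: \<tau>_def field_simps)
  have \<tau>_pi: "\<tau> < pi" using \<tau> pi_gt3 by linarith
  define K where "K = B / 6 + (1 / \<tau>) ^ 3"
  have K: "K \<ge> B / 6" "K \<ge> (1 / \<tau>) ^ 3" using B \<tau> by (auto simp: K_def)
  \<comment> \<open>\<open>exp (h x)\<close> is cut off at \<open>pi\<close> but the Gaussian is
    not, so the integral of \<open>f\<close> over the line is exactly the difference to be
    estimated.\<close>
  define f where "f x = (if x \<in> {-pi..pi} then exp (h x) else 0) - of_real (exp (- (A * x\<^sup>2 / 2)))" for x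
  define g where "g x = K * (\<bar>x\<bar> ^ 3 * exp (- (A * x\<^sup>2 / 4))) + (if x \<in> {-pi..pi} then exp (- M) else 0)" for x
  have gauss2: "((\<lambda>x. exp (- (A * x\<^sup>2 / 2))) has_integral sqrt (2 * pi / A)) UNIV"
    using has_integral_gaussian(1)[of "sqrt (1 / A)"] A by (simp add: field_simps)
  have gauss4: "((\<lambda>x. \<bar>x\<bar> ^ 3 * exp (- (A * x\<^sup>2 / 4))) has_integral 16 / A\<^sup>2) UNIV"
  proof -
    have "sqrt (2 / A) ^ 4 = (sqrt (2 / A) ^ 2) ^ 2" by (simp flip: power_mult)
    also have "\<dots> = 4 / A\<^sup>2" using A by (simp add: power_divide)
    finally have "4 * sqrt (2 / A) ^ 4 = 16 / A\<^sup>2" by simp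
    then show ?thesis
      using has_integral_gaussian(2)[of "sqrt (2 / A)"] A by (simp add: mult.commute)
  qed
  have "(\<lambda>x. exp (h x)) integrable_on {-pi..pi}"
    by (intro integrable_continuous_interval continuous_intros cont)
  then have "((\<lambda>x. exp (h x)) has_integral integral {-pi..pi} (\<lambda>x. exp (h x))) {-pi..pi}"
    by (rule integrable_integral)
  then have hf: "(f has_integral integral {-pi..pi} (\<lambda>x. exp (h x)) - of_real (sqrt (2 * pi / A))) UNIV"
    unfolding f_def
    by (intro has_integral_diff has_integral_of_real gauss2) (simp only: has_integral_restrict_UNIV)
  have "((\<lambda>x::real. exp (- M)) has_integral (pi - (-pi)) * exp (- M)) {-pi..pi}"
    using has_integral_const_real[of "exp (-M)" "-pi" pi] by simp
  then have hg: "(g has_integral K * (16 / A\<^sup>2) + 2 * pi * exp (- M)) UNIV"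
    unfolding g_def
    by (intro has_integral_add has_integral_mult_right gauss4) (simp only: has_integral_restrict_UNIV, simp)
  have far: "exp (- (A * x\<^sup>2 / 2)) \<le> K * (\<bar>x\<bar> ^ 3 * exp (- (A * x\<^sup>2 / 4)))" if "\<bar>x\<bar> > \<tau>" for x
  proof -
    have "1 \<le> \<bar>x\<bar> / \<tau>" using that \<tau> by simp
    then have "1 \<le> (\<bar>x\<bar> / \<tau>) ^ 3" by (rule one_le_power)
    also have "\<dots> = (1 / \<tau>) ^ 3 * \<bar>x\<bar> ^ 3" by (simp add: power_divide)
    also have "\<dots> \<le> K * \<bar>x\<bar> ^ 3" using K by (intro mult_right_mono) auto
    finally have 1: "1 \<le> K * \<bar>x\<bar> ^ 3" .
    have "exp (- (A * x\<^sup>2 / 2)) \<le> 1 * exp (- (A * x\<^sup>2 / 4))" using A by simp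
    also have "\<dots> \<le> (K * \<bar>x\<bar> ^ 3) * exp (- (A * x\<^sup>2 / 4))" using 1 by (intro mult_right_mono) auto
    finally show ?thesis by (simp add: mult_ac)
  qed
  have K0: "K \<ge> 0" using K B by linarith
  have bound: "norm (f x) \<le> g x" for x
  proof -
    consider "\<bar>x\<bar> \<le> \<tau>" | "\<bar>x\<bar> > \<tau>" "\<bar>x\<bar> \<le> pi" | "\<bar>x\<bar> > pi" by linarith
    then show ?thesis
    proof cases
      case 1
      then have x: "x \<in> {-pi..pi}" "\<bar>x\<bar> \<le> pi" using \<tau>_pi by auto
      have "Re (h x + of_real (A * x\<^sup>2 / 2)) \<le> B * \<bar>x\<bar> ^ 3 / 6"
        using taylor[OF x(2)] complex_Re_le_cmod[of "h x + of_real (A * x\<^sup>2 / 2)"] by linarith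
      moreover have "B * \<bar>x\<bar> ^ 3 / 6 \<le> A * x\<^sup>2 / 4"
      proof -
        have "B * \<bar>x\<bar> ^ 3 = (B * x\<^sup>2) * \<bar>x\<bar>" by (simp add: eval_nat_numeral abs_mult_self_eq)
        also have "\<dots> \<le> (B * x\<^sup>2) * \<tau>" using 1 B by (intro mult_left_mono) auto
        also have "\<dots> = 3 / 2 * A * x\<^sup>2" using B by (simp add: \<tau>_def)
        finally show ?thesis by simp
      qed
      ultimately have re: "Re (h x) \<le> - (A * x\<^sup>2 / 4)" by simp
      have "norm (f x) = norm (exp (h x) - exp (- of_real (A * x\<^sup>2 / 2)))"
        using x by (simp add: f_def exp_of_real [symmetric])
      also have "\<dots> \<le> exp (- (A * x\<^sup>2 / 4)) * norm (h x - (- of_real (A * x\<^sup>2 / 2)))"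
        using re A by (intro norm_exp_diff_le) auto
      also have "\<dots> \<le> exp (- (A * x\<^sup>2 / 4)) * (B * \<bar>x\<bar> ^ 3 / 6)"
        using taylor[OF x(2)] by (intro mult_left_mono) auto
      also have "\<dots> = (B / 6) * (\<bar>x\<bar> ^ 3 * exp (- (A * x\<^sup>2 / 4)))" by simp
      also have "\<dots> \<le> K * (\<bar>x\<bar> ^ 3 * exp (- (A * x\<^sup>2 / 4)))" using K by (intro mult_right_mono) auto
      also have "\<dots> \<le> g x" by (simp add: g_def)
      finally show ?thesis .
    next
      case 2
      then have x: "x \<in> {-pi..pi}" by auto
      have "norm (f x) \<le> norm (exp (h x)) + norm (of_real (exp (- (A * x\<^sup>2 / 2))) :: complex)"
        using x unfolding f_def by (simp only: if_True) (rule norm_triangle_ineq4)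
      also have "norm (exp (h x)) \<le> exp (- M)" using minor[of x] 2 by (simp add: \<tau>_def)
      also have "norm (of_real (exp (- (A * x\<^sup>2 / 2))) :: complex) \<le> K * (\<bar>x\<bar> ^ 3 * exp (- (A * x\<^sup>2 / 4)))"
        using far[OF 2(1)] by simp
      finally show ?thesis using x by (simp add: g_def)
    next
      case 3
      then have "x \<notin> {-pi..pi}" "\<bar>x\<bar> > \<tau>" using \<tau>_pi by auto
      then show ?thesis using far[of x] unfolding f_def g_def by (simp only: if_False) simp
    qed
  qed
  have "norm (integral UNIV f) \<le> integral UNIV g"
    using hf hg bound by (intro integral_norm_bound_integral) auto
  moreover have "1 / \<tau> = 2 * B / (3 * A)" by (simp add: \<tau>_def)
  ultimately show ?thesis
    using integral_unique[OF hf] integral_unique[OF hg] by (simp add: K_def)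
qed

text \<open>Cauchy's formula on a circle. Its parametrisation over \<open>{0..2*pi}\<close> is moved
  by periodicity to an interval centred at the saddle point \<open>\<theta> = 0\<close>.\<close>

lemma fps_expansion_coeff_integral:
  fixes f :: "complex \<Rightarrow> complex" and \<rho> :: real
  assumes holo: "f holomorphic_on ball 0 1" and \<rho>: "0 < \<rho>" "\<rho> < 1"
  shows "fps_nth (fps_expansion f 0) n =
     of_real \<rho> powi (- int n) / (2 * of_real pi) *
       integral {-pi..pi} (\<lambda>\<theta>. f (of_real \<rho> * cis \<theta>) * cis (- (real n * \<theta>)))"
proof -
  define g where "g \<theta> = f (of_real \<rho> * cis \<theta>) * cis (- (real n * \<theta>))" for \<theta> :: real
  define I where "I = (2 * pi * \<i>) / fact n * (deriv ^^ n) f 0"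
  have "((\<lambda>u. f u / (u - 0) ^ Suc n) has_contour_integral I) (circlepath 0 \<rho>)"
    unfolding I_def using holo \<rho>
    by (intro Cauchy_has_contour_integral_higher_derivative_circlepath holomorphic_on_imp_continuous_on)
       (auto elim!: holomorphic_on_subset)
  then have "((\<lambda>t. f (0 + \<rho> * cis t) / (0 + \<rho> * cis t - 0) ^ Suc n * \<rho> * \<i> * cis t) has_integral I) {0..2*pi}"
    unfolding circlepath_def by (subst (asm) has_contour_integral_part_circlepath_iff) auto
  also have "(\<lambda>t. f (0 + \<rho> * cis t) / (0 + \<rho> * cis t - 0) ^ Suc n * \<rho> * \<i> * cis t) =
      (\<lambda>t. (\<i> / of_real \<rho> ^ n) * g t)"
  proof
    fix t
    have "cis (- (real n * t)) = inverse (cis t ^ n)" by (metis Complex.DeMoivre cis_inverse)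
    then show "f (0 + \<rho> * cis t) / (0 + \<rho> * cis t - 0) ^ Suc n * \<rho> * \<i> * cis t = (\<i> / of_real \<rho> ^ n) * g t"
      using \<rho> by (simp add: g_def power_mult_distrib field_simps)
  qed
  finally have "((\<lambda>t. (\<i> / of_real \<rho> ^ n) * g t) has_integral I) {0..2*pi}" .
  from has_integral_mult_right[OF this, of "of_real \<rho> ^ n / \<i>"]
  have I: "(g has_integral (of_real \<rho> ^ n / \<i> * I)) {0..2*pi}" using \<rho> by simp
  have contg: "continuous_on S g" for S
  proof -
    have "continuous_on (ball 0 1) f" using holo by (rule holomorphic_on_imp_continuous_on)
    then have "continuous_on S (\<lambda>\<theta>. f (of_real \<rho> * cis \<theta>))"
      by (rule continuous_on_compose2) (use \<rho> in \<open>auto intro!: continuous_intros simp: norm_mult\<close>)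
    then show ?thesis unfolding g_def by (intro continuous_intros)
  qed
  then have gi: "g integrable_on {a..b}" for a b by (intro integrable_continuous_interval)
  have per: "g (2 * pi + x) = g x" for x
  proof -
    have "cis (2 * pi + x) = cis x" by (simp add: cis_mult [symmetric])
    moreover have "cis (- (real n * (2 * pi + x))) = cis (- (real n * x)) * cis (2 * pi * of_int (- int n))"
      by (simp only: cis_mult) (simp add: algebra_simps)
    moreover have "cis (2 * pi * of_int (- int n)) = 1" by (rule cis_multiple_2pi) auto
    ultimately show ?thesis by (simp add: g_def)
  qed
  have "integral {-pi..0} (g \<circ> ((+) (2*pi))) = integral {-pi+2*pi..0+2*pi} g"
    by (rule integral_shift_Icc_real)
  then have sh: "integral {-pi..0} g = integral {pi..2*pi} g" by (simp add: o_def per)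
  have "integral {-pi..pi} g = integral {-pi..0} g + integral {0..pi} g"
    by (intro Henstock_Kurzweil_Integration.integral_combine [symmetric] gi) auto
  also have "\<dots> = integral {0..pi} g + integral {pi..2*pi} g" by (simp add: sh)
  also have "\<dots> = integral {0..2*pi} g"
    by (intro Henstock_Kurzweil_Integration.integral_combine gi) auto
  also have "\<dots> = of_real \<rho> ^ n / \<i> * I" using I by (rule integral_unique)
  finally have "fps_nth (fps_expansion f 0) n = of_real \<rho> powi (- int n) / (2 * of_real pi) * integral {-pi..pi} g"
    using \<rho> by (simp add: fps_expansion_def I_def power_int_minus field_simps)
  then show ?thesis by (simp add: g_def [abs_def])
qed

section \<open>Moments and minor arcs\<close>

text \<open>This is \<open>ln v \<le> v\<close> at \<open>v = u / (2 * a)\<close>. Half of the decay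
  \<open>exp (- u)\<close> pays for the power; the other half remains to make a series
  geometric.\<close>

lemma powr_le_const_mult_exp_half:
  fixes u a :: real
  assumes "u \<ge> 0" "a > 0"
  shows "u powr a \<le> (2 * a) powr a * exp (u / 2)"
proof (cases "u = 0")
  case False
  define v where "v = u / (2 * a)"
  have v: "v > 0" using False assms by (simp add: v_def)
  have "v powr a = exp (a * ln v)" using v by (simp add: powr_def)
  also have "\<dots> \<le> exp (a * v)" using v assms ln_le_minus_one[of v] by simp
  also have "a * v = u / 2" using assms by (simp add: v_def)
  finally have "(2 * a) powr a * v powr a \<le> (2 * a) powr a * exp (u / 2)"
    by (intro mult_left_mono) auto
  moreover have "u = 2 * a * v" using assms by (simp add: v_def)
  then have "u powr a = (2 * a) powr a * v powr a" using assms v by (simp add: powr_mult)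
  ultimately show ?thesis by simp
qed simp

lemma euler_op_sums:
  fixes f :: "complex \<Rightarrow> complex" and a :: "nat \<Rightarrow> complex"
  assumes f: "\<And>z. norm z < 1 \<Longrightarrow> (\<lambda>n. a n * z ^ n) sums f z" and z: "norm z < 1"
  shows "(\<lambda>n. of_nat n * a n * z ^ n) sums euler_op f z"
proof -
  have holo: "f holomorphic_on ball 0 1"
    using f by (intro power_series_holomorphic[of 0 1 a f]) (auto simp: dist_norm)
  then have "(f has_field_derivative deriv f z) (at z)"
    using z by (intro holomorphic_derivI[of f "ball 0 1"]) auto
  then have "(\<lambda>n. diffs a n * z ^ n) sums deriv f z"
    using f z by (intro termdiffs_sums_strong) auto
  then have "(\<lambda>n. z * (diffs a n * z ^ n)) sums (z * deriv f z)" by (rule sums_mult)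
  then have "(\<lambda>n. of_nat (Suc n) * a (Suc n) * z ^ Suc n) sums (z * deriv f z)"
    by (simp add: diffs_def mult_ac)
  then show ?thesis
    using sums_Suc_iff[of "\<lambda>n. of_nat n * a n * z ^ n" "z * deriv f z"] by (simp add: euler_op_def)
qed

locale prime_dominated_weights =
  fixes b :: "nat \<Rightarrow> real" and C c :: real and s s' :: nat
  assumes b_nonneg: "b k \<ge> 0"
    and b_le: "b k \<le> C * real k powr (1/100)"
    and c_pos: "c > 0"
    and s_coprime: "coprime s s'"
    and b_ge: "prime p \<Longrightarrow> c \<le> b (s * p)" "prime p \<Longrightarrow> c \<le> b (s' * p)"
begin

text \<open>\<open>0 powr (1/100)\<close> is \<open>0\<close>, so the two bounds on \<open>b\<close>
  meet at index \<open>0\<close>.\<close>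

lemma b_0: "b 0 = 0"
  using b_nonneg[of 0] b_le[of 0] by simp

lemma s_pos: "s > 0" "s' > 0"
  using b_ge[of 2] b_0 c_pos by (auto intro!: Nat.gr0I)

lemma C_nonneg: "C \<ge> 0"
  using b_nonneg[of 1] b_le[of 1] by simp

text \<open>At \<open>x = exp (- t)\<close> this is the \<open>k\<close>-th iterate of
  \<open>x * d/dx\<close> on the power series with coefficients \<open>b\<close>: order
  \<open>1\<close> enters the saddle point equation, order \<open>2\<close> is the quadratic
  coefficient of the exponent.\<close>

definition moment :: "nat \<Rightarrow> real \<Rightarrow> real" where
  "moment k t = (\<Sum>m. b m * real m ^ k * exp (- (t * real m)))"

lemma moment_term_le:
  fixes k m :: nat
  assumes t: "t > 0"
  defines "a \<equiv> real k + 1/100"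
  shows "b m * real m ^ k * exp (- (t * real m)) \<le> C * (2 * a) powr a * t powr (-a) * exp (- (t / 2)) ^ m"
proof (cases "m = 0")
  case True
  then show ?thesis using b_0 C_nonneg by simp
next
  case False
  have a: "a > 0" by (simp add: a_def)
  have "b m * real m ^ k \<le> C * real m powr (1/100) * real m ^ k"
    using b_le by (intro mult_right_mono) auto
  also have "\<dots> = C * real m powr a"
    using False by (simp add: a_def powr_add powr_realpow mult.commute)
  also have "real m powr a = (t * real m) powr a * t powr (-a)"
    using t by (simp add: powr_mult powr_minus field_simps)
  also have "C * ((t * real m) powr a * t powr (-a)) \<le> C * ((2 * a) powr a * exp (t * real m / 2) * t powr (-a))"
    using t a C_nonneg by (intro mult_left_mono mult_right_mono powr_le_const_mult_exp_half) auto
  finally have "b m * real m ^ k * exp (- (t * real m)) \<le> 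
      C * ((2 * a) powr a * exp (t * real m / 2) * t powr (-a)) * exp (- (t * real m))"
    by (rule mult_right_mono) simp
  also have "\<dots> = C * (2 * a) powr a * t powr (-a) * (exp (t * real m / 2) * exp (- (t * real m)))"
    by (simp add: mult_ac)
  also have "exp (t * real m / 2) * exp (- (t * real m)) = exp (- (t / 2)) ^ m"
    by (simp flip: exp_add exp_of_nat_mult)
  finally show ?thesis .
qed

lemma moment_term_nonneg: "b m * real m ^ k * exp (- (t * real m)) \<ge> 0"
  using b_nonneg by simp

lemma summable_moment:
  assumes "t > 0"
  shows "summable (\<lambda>m. b m * real m ^ k * exp (- (t * real m)))"
proof (rule summable_comparison_test)
  show "summable (\<lambda>m. C * (2 * (real k + 1/100)) powr (real k + 1/100) * t powr (-(real k + 1/100)) * exp (- (t / 2)) ^ m)"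
    using assms by (intro summable_mult summable_geometric) auto
  show "\<exists>N. \<forall>n\<ge>N. norm (b n * real n ^ k * exp (- (t * real n))) \<le>
      C * (2 * (real k + 1/100)) powr (real k + 1/100) * t powr (-(real k + 1/100)) * exp (- (t / 2)) ^ n"
    using moment_term_le[OF assms, of _ k] b_nonneg by (simp add: abs_mult)
qed

text \<open>Absorbing \<open>m powr (k + 1/100)\<close> costs \<open>t powr (-(k + 1/100))\<close>;
  the remaining geometric series of ratio \<open>exp (- (t / 2))\<close> costs one more factor of
  order \<open>1 / t\<close>.\<close>

lemma moment_le: "\<exists>K>0. \<forall>t. 0 < t \<and> t \<le> 1 \<longrightarrow> moment k t \<le> K * t powr (-(real k + 101/100))"
proof -
  define a where "a = real k + 1/100"
  define K where "K = C * (2 * a) powr a"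
  have K0: "K \<ge> 0" using C_nonneg by (simp add: K_def)
  \<comment> \<open>Only \<open>C \<ge> 0\<close> is at hand, so \<open>+ 1\<close> makes the
    constant positive.\<close>
  have "moment k t \<le> (4 * K + 1) * t powr (-(real k + 101/100))" if t: "0 < t" "t \<le> 1" for t
  proof -
    have "moment k t \<le> (\<Sum>m. K * t powr (-a) * exp (- (t / 2)) ^ m)"
      unfolding moment_def K_def a_def
      using t by (intro suminf_le moment_term_le summable_moment summable_mult summable_geometric) auto
    also have "\<dots> = K * t powr (-a) * (1 / (1 - exp (- (t / 2))))"
      using t by (subst suminf_mult) (auto simp: suminf_geometric intro!: summable_geometric)
    also have "\<dots> \<le> K * t powr (-a) * (4 / t)"
    proof (intro mult_left_mono)
      have "exp (- (t / 2)) \<le> 1 / (1 + t / 2)"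
        using t exp_ge_add_one_self[of "t / 2"] by (simp add: exp_minus inverse_eq_divide frac_le)
      also have "\<dots> \<le> 1 - t / 4" using t by (simp add: field_simps)
      finally have "1 - exp (- (t / 2)) \<ge> t / 4" by simp
      then have "1 / (1 - exp (- (t / 2))) \<le> 1 / (t / 4)" using t by (intro divide_left_mono mult_pos_pos) auto
      then show "1 / (1 - exp (- (t / 2))) \<le> 4 / t" by simp
    qed (use K0 in auto)
    also have "\<dots> = 4 * K * t powr (-(real k + 101/100))"
    proof -
      have "t powr (-(real k + 101/100)) = t powr (-a - 1)" by (simp add: a_def algebra_simps)
      also have "\<dots> = t powr (-a) / t" using t by (subst powr_diff) auto
      finally show ?thesis by simp
    qed
    also have "\<dots> \<le> (4 * K + 1) * t powr (-(real k + 101/100))" by (intro mult_right_mono) auto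
    finally show ?thesis .
  qed
  then show ?thesis using K0 by (intro exI[of _ "4 * K + 1"]) auto
qed

text \<open>For \<open>p \<le> 1 / t\<close> the factor \<open>exp (- (t * \<sigma> * p))\<close> is
  at least \<open>exp (- \<sigma>)\<close>. The weight \<open>w\<close> is left free: powers of
  \<open>m\<close> for the moments, \<open>1 - cos (m * \<theta>)\<close> for the minor
  arcs.\<close>

lemma sum_primes_le_suminf:
  assumes \<sigma>: "\<sigma> = s \<or> \<sigma> = s'" and t: "t > 0" and w: "\<And>m. w m \<ge> 0"
    and sm: "summable (\<lambda>m. b m * w m * exp (- (t * real m)))"
  shows "c * exp (- real \<sigma>) * (\<Sum>p\<in>primes_upto (1 / t). w (\<sigma> * p)) \<le> (\<Sum>m. b m * w m * exp (- (t * real m)))"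
proof -
  have \<sigma>0: "\<sigma> > 0" using \<sigma> s_pos by auto
  have "c * exp (- real \<sigma>) * (\<Sum>p\<in>primes_upto (1 / t). w (\<sigma> * p)) = 
      (\<Sum>p\<in>primes_upto (1 / t). c * w (\<sigma> * p) * exp (- real \<sigma>))"
    by (simp add: sum_distrib_left sum_distrib_right mult_ac)
  also have "\<dots> \<le> (\<Sum>p\<in>primes_upto (1 / t). b (\<sigma> * p) * w (\<sigma> * p) * exp (- (t * real (\<sigma> * p))))"
  proof (intro sum_mono mult_mono mult_right_mono)
    fix p assume p: "p \<in> primes_upto (1 / t)"
    then show "c \<le> b (\<sigma> * p)" using \<sigma> b_ge by (auto simp: primes_upto_def)
    have "t * real p \<le> 1" using p t by (simp add: primes_upto_def field_simps)
    then have "real \<sigma> * (t * real p) \<le> real \<sigma> * 1" by (intro mult_left_mono) auto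
    then show "exp (- real \<sigma>) \<le> exp (- (t * real (\<sigma> * p)))" by (simp add: mult_ac)
  qed (use w b_nonneg in auto)
  also have "\<dots> = (\<Sum>m\<in>(\<lambda>p. \<sigma> * p) ` primes_upto (1 / t). b m * w m * exp (- (t * real m)))"
    using \<sigma>0 by (subst sum.reindex) (auto simp: inj_on_def)
  also have "\<dots> \<le> (\<Sum>m. b m * w m * exp (- (t * real m)))"
    using sm w b_nonneg by (intro sum_le_suminf) auto
  finally show ?thesis .
qed

lemma moment_ge:
  "\<exists>K>0. eventually (\<lambda>t. K * t powr (- (99/100 * real (Suc k))) \<le> moment k t) (at_right 0)"
proof -
  define K where "K = c * exp (- real s) * (1/2) ^ Suc k"
  have lim: "filterlim (\<lambda>t::real. 1 / t) at_top (at_right 0)" by real_asymp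
  have "eventually (\<lambda>t. real (card (primes_upto (1 / t))) \<ge> (1 / t) powr (99/100)) (at_right 0)"
    by (rule eventually_compose_filterlim[OF eventually_card_primes_upto_ge lim])
  moreover have "eventually (\<lambda>t::real. t > 0) (at_right 0)" by (rule eventually_at_right_less)
  ultimately have "eventually (\<lambda>t. K * t powr (- (99/100 * real (Suc k))) \<le> moment k t) (at_right 0)"
  proof eventually_elim
    case (elim t)
    have "K * t powr (- (99/100 * real (Suc k))) = c * exp (- real s) * ((1 / t) powr (99/100) / 2) ^ Suc k"
    proof -
      have "((1 / t) powr (99/100)) ^ Suc k = (1 / t) powr (99/100 * real (Suc k))"
        using elim by (subst powr_power) (auto simp: mult.commute)
      also have "\<dots> = t powr (- (99/100 * real (Suc k)))"
        using elim by (simp add: powr_divide powr_minus_divide)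
      finally show ?thesis unfolding power_divide K_def by (simp add: power_divide)
    qed
    also have "\<dots> \<le> c * exp (- real s) * (\<Sum>p\<in>primes_upto (1 / t). real p ^ k)"
      using elim c_pos by (intro mult_left_mono sum_prime_powers_ge) auto
    also have "\<dots> \<le> c * exp (- real s) * (\<Sum>p\<in>primes_upto (1 / t). real (s * p) ^ k)"
      using s_pos c_pos by (intro mult_left_mono sum_mono power_mono of_nat_mono) auto
    also have "\<dots> \<le> moment k t"
      unfolding moment_def using elim by (intro sum_primes_le_suminf summable_moment) auto
    finally show ?case .
  qed
  moreover have "K > 0" using c_pos by (simp add: K_def)
  ultimately show ?thesis by blast
qed

lemma summable_cos:
  assumes "t > 0"
  shows "summable (\<lambda>m. b m * (1 - cos (real m * \<theta>)) * exp (- (t * real m)))"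
proof (rule summable_comparison_test)
  show "summable (\<lambda>m. 2 * (b m * real m ^ 0 * exp (- (t * real m))))"
    by (intro summable_mult summable_moment assms)
  have "b m * (1 - cos (real m * \<theta>)) \<le> b m * 2" for m
    using b_nonneg[of m] cos_ge_minus_one[of "real m * \<theta>"] by (intro mult_left_mono) linarith+
  then have "b m * (1 - cos (real m * \<theta>)) * exp (- (t * real m)) \<le> b m * 2 * exp (- (t * real m))" for m
    by (rule mult_right_mono) simp
  then show "\<exists>N. \<forall>n\<ge>N. norm (b n * (1 - cos (real n * \<theta>)) * exp (- (t * real n))) \<le> 2 * (b n * real n ^ 0 * exp (- (t * real n)))"
    using b_nonneg by (simp add: abs_mult mult_ac)
qed

text \<open>The estimate over primes up to \<open>1 / t\<close> is applied to
  \<open>\<sigma> * \<theta> / (2 * pi)\<close>, with \<open>\<sigma>\<close> whichever of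
  \<open>s\<close> and \<open>s'\<close> does not bring the angle too near an integer.\<close>

lemma minor_arc_bound:
  "\<exists>K>0. eventually (\<lambda>t. \<forall>\<theta>. K * min (t powr (-29/10) * (int_dist (\<theta> / (2 * pi)))\<^sup>2) (t powr (-1/5))
      \<le> (\<Sum>m. b m * (1 - cos (real m * \<theta>)) * exp (- (t * real m)))) (at_right 0)"
proof -
  obtain \<kappa> where \<kappa>: "\<kappa> > 0" 
    "\<And>\<alpha>. int_dist (real s * \<alpha>) \<ge> \<kappa> * int_dist \<alpha> \<or> int_dist (real s' * \<alpha>) \<ge> \<kappa> * int_dist \<alpha>"
    using int_dist_two_multiples_ge[OF s_coprime] by blast
  \<comment> \<open>The loss \<open>\<kappa>^2\<close> hits only the first argument of
    \<open>min\<close>; capped at \<open>1\<close>, it can be pulled out of both. In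
    \<open>K\<close>, \<open>max s s'\<close> makes the constant independent of the choice of
    \<open>\<sigma>\<close>, which varies with \<theta>.\<close>
  define \<mu> where "\<mu> = min (\<kappa>\<^sup>2) 1"
  define K where "K = c * exp (- real (max s s')) * \<mu>"
  have \<mu>: "\<mu> > 0" "\<mu> \<le> 1" "\<mu> \<le> \<kappa>\<^sup>2" using \<kappa> by (auto simp: \<mu>_def)
  have lim: "filterlim (\<lambda>t::real. 1 / t) at_top (at_right 0)" by real_asymp
  have "eventually (\<lambda>t. \<forall>\<alpha>. (\<Sum>p\<in>primes_upto (1 / t). (int_dist (real p * \<alpha>))\<^sup>2)
       \<ge> min ((1 / t) powr (29/10) * (int_dist \<alpha>)\<^sup>2) ((1 / t) powr (1/5))) (at_right 0)"
    by (rule eventually_compose_filterlim[OF eventually_sum_int_dist_primes_ge lim])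
  moreover have "eventually (\<lambda>t::real. t > 0) (at_right 0)" by (rule eventually_at_right_less)
  ultimately have "eventually (\<lambda>t. \<forall>\<theta>. K * min (t powr (-29/10) * (int_dist (\<theta> / (2 * pi)))\<^sup>2) (t powr (-1/5))
      \<le> (\<Sum>m. b m * (1 - cos (real m * \<theta>)) * exp (- (t * real m)))) (at_right 0)"
  proof eventually_elim
    case (elim t)
    show ?case
    proof
      fix \<theta> :: real
      define \<alpha> where "\<alpha> = \<theta> / (2 * pi)"
      define X where "X = 1 / t"
      have X: "t powr (-29/10) = X powr (29/10)" "t powr (-1/5) = X powr (1/5)"
        using elim by (simp_all add: X_def powr_divide powr_minus_divide)
      obtain \<sigma> where \<sigma>: "\<sigma> = s \<or> \<sigma> = s'" "int_dist (real \<sigma> * \<alpha>) \<ge> \<kappa> * int_dist \<alpha>"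
        using \<kappa>(2)[of \<alpha>] by blast
      have "\<mu> * (int_dist \<alpha>)\<^sup>2 \<le> \<kappa>\<^sup>2 * (int_dist \<alpha>)\<^sup>2" using \<mu> by (intro mult_right_mono) auto
      also have "\<dots> = (\<kappa> * int_dist \<alpha>)\<^sup>2" by (simp add: power_mult_distrib)
      also have "\<dots> \<le> (int_dist (real \<sigma> * \<alpha>))\<^sup>2" using \<sigma> \<kappa> by (intro power_mono) auto
      finally have d: "X powr (29/10) * (\<mu> * (int_dist \<alpha>)\<^sup>2) \<le> X powr (29/10) * (int_dist (real \<sigma> * \<alpha>))\<^sup>2"
        by (intro mult_left_mono) auto
      have "\<mu> * min (X powr (29/10) * (int_dist \<alpha>)\<^sup>2) (X powr (1/5)) = 
          min (X powr (29/10) * (\<mu> * (int_dist \<alpha>)\<^sup>2)) (\<mu> * X powr (1/5))"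
        using \<mu> by (simp add: min_mult_distrib_left mult_ac)
      also have "\<dots> \<le> min (X powr (29/10) * (int_dist (real \<sigma> * \<alpha>))\<^sup>2) (1 * X powr (1/5))"
        using d \<mu> by (intro min.mono mult_right_mono) auto
      also have "\<dots> \<le> (\<Sum>p\<in>primes_upto X. (int_dist (real p * (real \<sigma> * \<alpha>)))\<^sup>2)"
        using elim by (simp add: X_def)
      also have "\<dots> \<le> (\<Sum>p\<in>primes_upto X. 1 - cos (real (\<sigma> * p) * \<theta>))"
      proof (intro sum_mono)
        fix p
        have "2 * pi * (real p * (real \<sigma> * \<alpha>)) = real (\<sigma> * p) * \<theta>" by (simp add: \<alpha>_def)
        then show "(int_dist (real p * (real \<sigma> * \<alpha>)))\<^sup>2 \<le> 1 - cos (real (\<sigma> * p) * \<theta>)"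
          using int_dist_square_le_one_minus_cos[of "real p * (real \<sigma> * \<alpha>)"] by (simp only:)
      qed
      finally have 1: "\<mu> * min (X powr (29/10) * (int_dist \<alpha>)\<^sup>2) (X powr (1/5)) \<le>
          (\<Sum>p\<in>primes_upto X. 1 - cos (real (\<sigma> * p) * \<theta>))" .
      have "c * exp (- real (max s s')) * (\<mu> * min (X powr (29/10) * (int_dist \<alpha>)\<^sup>2) (X powr (1/5))) \<le>
         c * exp (- real \<sigma>) * (\<Sum>p\<in>primes_upto X. 1 - cos (real (\<sigma> * p) * \<theta>))"
        using 1 \<sigma> c_pos \<mu> by (intro mult_mono) auto
      also have "\<dots> \<le> (\<Sum>m. b m * (1 - cos (real m * \<theta>)) * exp (- (t * real m)))"
        unfolding X_def using elim \<sigma> by (intro sum_primes_le_suminf summable_cos) auto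
      finally show "K * min (t powr (-29/10) * (int_dist (\<theta> / (2 * pi)))\<^sup>2) (t powr (-1/5)) \<le> \<dots>"
        unfolding X K_def \<alpha>_def by (simp only: mult.assoc)
    qed
  qed
  moreover have "K > 0" using c_pos \<mu> by (simp add: K_def)
  ultimately show ?thesis by blast
qed

text \<open>No term increases with \<open>t\<close>, and the one at \<open>s * 2\<close> strictly
  decreases. This yields uniqueness of the saddle point and drives it to \<open>1\<close> as
  \<open>n\<close> grows.\<close>

lemma moment_1_strict_antimono:
  assumes "0 < t" "t < t'"
  shows "moment 1 t' < moment 1 t"
proof -
  let ?f = "\<lambda>t m. b m * real m ^ 1 * exp (- (t * real m))"
  have sm: "summable (?f t)" "summable (?f t')" using assms summable_moment[of _ 1] by simp_all
  have "0 < (\<Sum>m. ?f t m - ?f t' m)"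
  proof (rule suminf_pos2)
    show "summable (\<lambda>m. ?f t m - ?f t' m)" by (intro summable_diff sm)
    show "0 \<le> ?f t m - ?f t' m" for m
      using assms b_nonneg[of m] by (auto intro!: mult_left_mono mult_right_mono)
    have "b (s * 2) > 0" using b_ge(1)[of 2] c_pos by simp
    then show "0 < ?f t (s * 2) - ?f t' (s * 2)"
      using assms s_pos by (auto intro!: mult_strict_left_mono)
  qed
  also have "\<dots> = moment 1 t - moment 1 t'" unfolding moment_def by (rule suminf_diff [symmetric]) (rule sm)+
  finally show ?thesis by simp
qed

text \<open>At \<open>m = 0\<close> and \<open>k = 0\<close> the powers compare the wrong way, since
  \<open>0 ^ 0 = 1\<close>; there \<open>b 0 = 0\<close> helps.\<close>

lemma moment_Suc_mono:
  assumes "t > 0"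
  shows "moment k t \<le> moment (Suc k) t"
  unfolding moment_def
proof (intro suminf_le summable_moment assms)
  fix m
  show "b m * real m ^ k * exp (- (t * real m)) \<le> b m * real m ^ Suc k * exp (- (t * real m))"
  proof (cases "m = 0")
    case False
    then show ?thesis using b_nonneg[of m] by (intro mult_right_mono mult_left_mono power_increasing) auto
  qed (simp add: b_0)
qed

lemma summable_b:
  assumes "0 \<le> x" "x < 1"
  shows "summable (\<lambda>k. b k * x ^ k)"
proof (cases "x = 0")
  case True
  then show ?thesis by (simp add: summable_0_powser)
next
  case False
  then have "- ln x > 0" using assms by simp
  from summable_moment[OF this, of 0] show ?thesis
    using False assms by (simp add: exp_of_nat2_mult)
qed

end

section \<open>Coefficients of the exponential of a power series\<close>

locale exp_series = prime_dominated_weights +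
  fixes \<Phi> \<Psi> :: "complex \<Rightarrow> complex"
  assumes Phi_sums: "norm z < 1 \<Longrightarrow> (\<lambda>k. of_real (b k) * z ^ k) sums \<Phi> z"
    and Psi_eq: "norm z < 1 \<Longrightarrow> \<Psi> z = exp (\<Phi> z)"
begin

lemma Phi_holomorphic: "\<Phi> holomorphic_on ball 0 1"
  using Phi_sums by (intro power_series_holomorphic[of 0 1 "\<lambda>k. of_real (b k)"]) (auto simp: dist_norm)

lemma Psi_holomorphic: "\<Psi> holomorphic_on ball 0 1"
proof -
  have "(\<lambda>z. exp (\<Phi> z)) holomorphic_on ball 0 1" by (intro holomorphic_intros Phi_holomorphic)
  then show ?thesis by (rule holomorphic_transform) (simp add: Psi_eq)
qed

lemma euler_Phi_sums:
  assumes "norm z < 1"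
  shows "(\<lambda>m. of_nat m * of_real (b m) * z ^ m) sums euler_op \<Phi> z"
    and "(\<lambda>m. of_nat m * (of_nat m * of_real (b m)) * z ^ m) sums (euler_op ^^ 2) \<Phi> z"
proof -
  have *: "(\<lambda>m. of_nat m * of_real (b m) * z ^ m) sums euler_op \<Phi> z" if "norm z < 1" for z
    using Phi_sums that by (rule euler_op_sums)
  show "(\<lambda>m. of_nat m * of_real (b m) * z ^ m) sums euler_op \<Phi> z"
    using assms by (rule *)
  show "(\<lambda>m. of_nat m * (of_nat m * of_real (b m)) * z ^ m) sums (euler_op ^^ 2) \<Phi> z"
    unfolding numeral_2_eq_2 funpow.simps o_def id_def using * assms by (rule euler_op_sums)
qed

lemma exp_neg_power: "of_real (exp (- t)) ^ m = (of_real (exp (- (t * real m))) :: complex)"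
  by (simp add: mult.commute flip: of_real_power exp_of_nat_mult)

lemma euler_Phi_eq:
  assumes t: "t > 0"
  shows "euler_op \<Phi> (of_real (exp (- t))) = of_real (moment 1 t)"
    and "(euler_op ^^ 2) \<Phi> (of_real (exp (- t))) = of_real (moment 2 t)"
proof -
  have z: "norm (of_real (exp (- t)) :: complex) < 1" using t by simp
  have "(\<lambda>m. of_real (b m * real m ^ 1 * exp (- (t * real m))) :: complex) sums of_real (moment 1 t)"
    unfolding moment_def using summable_moment[OF t, of 1] by (intro sums_of_real summable_sums) auto
  then show "euler_op \<Phi> (of_real (exp (- t))) = of_real (moment 1 t)"
    using euler_Phi_sums(1)[OF z] unfolding exp_neg_power by (simp add: mult_ac sums_unique2)
  have "(\<lambda>m. of_real (b m * real m ^ 2 * exp (- (t * real m))) :: complex) sums of_real (moment 2 t)"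
    unfolding moment_def using summable_moment[OF t, of 2] by (intro sums_of_real summable_sums) auto
  then show "(euler_op ^^ 2) \<Phi> (of_real (exp (- t))) = of_real (moment 2 t)"
    using euler_Phi_sums(2)[OF z] unfolding exp_neg_power by (simp add: mult_ac sums_unique2 power2_eq_square)
qed

text \<open>Under \<open>x = exp (- t)\<close> the Euler derivative of \<open>\<Phi>\<close> takes
  the real value \<open>moment 1 t\<close>, so the complex equation becomes a real one for a
  strictly decreasing function.\<close>

lemma saddle_point_iff:
  "saddle_point \<Phi> n x \<longleftrightarrow> (\<exists>t>0. x = exp (- t) \<and> real n = moment 1 t)"
proof
  assume sp: "saddle_point \<Phi> n x"
  define t where "t = - ln x"
  have x: "0 < x" "x < 1" using sp by (auto simp: saddle_point_def)
  have t: "t > 0" "x = exp (- t)" using x by (simp_all add: t_def)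
  have "of_nat n = euler_op \<Phi> (of_real x)" using sp by (simp add: saddle_point_def euler_op_def)
  also have "\<dots> = of_real (moment 1 t)" using euler_Phi_eq(1)[OF t(1)] t(2) by simp
  finally have "complex_of_real (real n) = of_real (moment 1 t)" by simp
  then have "real n = moment 1 t" by (simp only: of_real_eq_iff)
  then show "\<exists>t>0. x = exp (- t) \<and> real n = moment 1 t" using t by blast
next
  assume "\<exists>t>0. x = exp (- t) \<and> real n = moment 1 t"
  then obtain t where t: "t > 0" "x = exp (- t)" "real n = moment 1 t" by blast
  have "(of_nat n :: complex) = of_real (moment 1 t)" using t(3) by (metis of_real_of_nat_eq)
  then show "saddle_point \<Phi> n x"
    using t euler_Phi_eq(1)[OF t(1)] by (simp add: saddle_point_def euler_op_def)
qed

lemma continuous_on_moment_1: "continuous_on {0<..} (moment 1)"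
proof -
  have "euler_op \<Phi> holomorphic_on ball 0 1"
    unfolding euler_op_def by (intro holomorphic_intros Phi_holomorphic) auto
  then have "continuous_on {0<..} (\<lambda>t. euler_op \<Phi> (of_real (exp (- t))))"
    by (intro continuous_on_compose2[OF holomorphic_on_imp_continuous_on[of "euler_op \<Phi>" "ball 0 1"]])
       (auto intro!: continuous_intros)
  then have "continuous_on {0<..} (\<lambda>t. Re (euler_op \<Phi> (of_real (exp (- t)))))"
    by (intro continuous_intros)
  then show ?thesis
    by (rule continuous_on_eq) (simp add: euler_Phi_eq)
qed

text \<open>\<open>moment 1\<close> is continuous, strictly decreasing and unbounded near
  \<open>0\<close>, so every \<open>n \<ge> moment 1 1\<close> is attained exactly once.\<close>

lemma eventually_unique_saddle_point: "eventually (\<lambda>n. \<exists>!x. saddle_point \<Phi> n x) sequentially"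
proof -
  obtain K where K: "K > 0" "eventually (\<lambda>t. K * t powr (- (99/100 * real (Suc 1))) \<le> moment 1 t) (at_right 0)"
    using moment_ge[of 1] by blast
  have "filterlim (\<lambda>t. K * t powr (- (99/100 * real (Suc 1)))) at_top (at_right 0)"
    using K(1) by real_asymp
  then have top: "filterlim (moment 1) at_top (at_right 0)"
    using K(2) by (rule filterlim_at_top_mono)
  have "eventually (\<lambda>n. real n \<ge> moment 1 1) sequentially"
    using filterlim_real_sequentially by (simp add: filterlim_at_top)
  then show ?thesis
  proof eventually_elim
    case (elim n)
    have "eventually (\<lambda>t. moment 1 t \<ge> real n) (at_right 0)" "eventually (\<lambda>t. t < (1::real)) (at_right 0)"
      "eventually (\<lambda>t. t > (0::real)) (at_right 0)"
      using top by (auto simp: filterlim_at_top eventually_at_right_less intro: eventually_at_right_less order_tendstoD)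
    then have "eventually (\<lambda>t. moment 1 t \<ge> real n \<and> t < 1 \<and> t > 0) (at_right 0)"
      by eventually_elim auto
    then obtain u where u: "moment 1 u \<ge> real n" "u < 1" "u > 0"
      using eventually_happens[of _ "at_right (0::real)"] by auto
    have "\<exists>t. u \<le> t \<and> t \<le> 1 \<and> moment 1 t = real n"
      using u elim by (intro IVT2' continuous_on_subset[OF continuous_on_moment_1]) auto
    then obtain t where t: "t > 0" "moment 1 t = real n" using u by (meson less_le_trans)
    show ?case
    proof (rule ex1I[of _ "exp (- t)"])
      show "saddle_point \<Phi> n (exp (- t))" using t by (auto simp: saddle_point_iff)
    next
      fix x assume "saddle_point \<Phi> n x"
      then obtain t' where t': "t' > 0" "x = exp (- t')" "real n = moment 1 t'" by (auto simp: saddle_point_iff)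
      then have "t' = t"
        using t moment_1_strict_antimono[of t t'] moment_1_strict_antimono[of t' t] by (cases t t' rule: linorder_cases) auto
      then show "x = exp (- t)" using t' by simp
    qed
  qed
qed

text \<open>When \<open>real n = moment 1 t\<close>, this is the exponent of the Cauchy integrand
  relative to its value at \<open>\<theta> = 0\<close>. The subtracted linear term comes from
  \<open>cis (- (n * \<theta>))\<close> and cancels the first-order Taylor term.\<close>

definition phase :: "real \<Rightarrow> real \<Rightarrow> complex" where
  "phase t \<theta> = \<Phi> (of_real (exp (- t)) * cis \<theta>) - \<Phi> (of_real (exp (- t))) - \<i> * of_real (moment 1 t * \<theta>)"

lemma phase_sums:
  assumes t: "t > 0"
  shows "(\<lambda>m. of_real (b m * exp (- (t * real m))) * (cis (real m * \<theta>) - 1 - \<i> * of_real (real m * \<theta>)))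
           sums phase t \<theta>"
proof -
  have pow: "(of_real (exp (- t)) * cis \<theta>) ^ m = of_real (exp (- (t * real m))) * cis (real m * \<theta>)" for m
    by (simp only: power_mult_distrib exp_neg_power Complex.DeMoivre)
  have "(\<lambda>m. of_real (b m) * (of_real (exp (- t)) * cis \<theta>) ^ m) sums \<Phi> (of_real (exp (- t)) * cis \<theta>)"
    "(\<lambda>m. of_real (b m) * of_real (exp (- t)) ^ m) sums \<Phi> (of_real (exp (- t)))"
    using t by (auto intro!: Phi_sums simp: norm_mult simp del: of_real_exp)
  moreover have "(\<lambda>m. \<i> * of_real (b m * real m ^ 1 * exp (- (t * real m)) * \<theta>)) sums (\<i> * of_real (moment 1 t * \<theta>))"
    unfolding moment_def using summable_moment[OF t, of 1]
    by (intro sums_mult sums_of_real sums_mult2 summable_sums) auto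
  ultimately have "(\<lambda>m. of_real (b m) * (of_real (exp (- t)) * cis \<theta>) ^ m - of_real (b m) * of_real (exp (- t)) ^ m
       - \<i> * of_real (b m * real m ^ 1 * exp (- (t * real m)) * \<theta>)) sums phase t \<theta>"
    unfolding phase_def by (intro sums_diff)
  then show ?thesis
    unfolding pow exp_neg_power by (simp add: algebra_simps)
qed

lemma Re_phase:
  assumes "t > 0"
  shows "Re (phase t \<theta>) = - (\<Sum>m. b m * (1 - cos (real m * \<theta>)) * exp (- (t * real m)))"
proof -
  have "(\<lambda>m. - (b m * (1 - cos (real m * \<theta>)) * exp (- (t * real m)))) sums Re (phase t \<theta>)"
    using sums_Re[OF phase_sums[OF assms, of \<theta>]] by (simp add: algebra_simps)
  then show ?thesis
    using summable_cos[OF assms, of \<theta>] by (metis suminf_minus sums_unique)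
qed

text \<open>Each term carries a Taylor remainder of \<open>iexp\<close> of size at most
  \<open>(m * \<bar>\<theta>\<bar>) ^ 3 / 6\<close>; as the weights are nonnegative, these bounds
  add up to the third moment.\<close>

lemma phase_taylor:
  assumes t: "t > 0"
  shows "norm (phase t \<theta> + of_real (moment 2 t * \<theta>\<^sup>2 / 2)) \<le> moment 3 t * \<bar>\<theta>\<bar> ^ 3 / 6"
proof -
  define f where "f m = of_real (b m * exp (- (t * real m))) * 
      (cis (real m * \<theta>) - 1 - \<i> * of_real (real m * \<theta>) + of_real ((real m * \<theta>)\<^sup>2 / 2))" for m
  define g where "g m = b m * real m ^ 3 * exp (- (t * real m)) * (\<bar>\<theta>\<bar> ^ 3 / 6)" for m
  have "(\<lambda>m. of_real (b m * real m ^ 2 * exp (- (t * real m)) * (\<theta>\<^sup>2 / 2)) :: complex) sums of_real (moment 2 t * (\<theta>\<^sup>2 / 2))"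
    unfolding moment_def using summable_moment[OF t, of 2] by (intro sums_of_real sums_mult2 summable_sums)
  from sums_add[OF phase_sums[OF t, of \<theta>] this]
  have f: "f sums (phase t \<theta> + of_real (moment 2 t * \<theta>\<^sup>2 / 2))"
    by (simp add: f_def [abs_def] algebra_simps power_mult_distrib)
  have g: "g sums (moment 3 t * (\<bar>\<theta>\<bar> ^ 3 / 6))"
    unfolding moment_def g_def using summable_moment[OF t, of 3] by (intro sums_mult2 summable_sums)
  have fg: "norm (f m) \<le> g m" for m
  proof -
    have "norm (cis (real m * \<theta>) - 1 - \<i> * of_real (real m * \<theta>) + of_real ((real m * \<theta>)\<^sup>2 / 2)) =
       norm (iexp (real m * \<theta>) - (\<Sum>k\<le>2. (\<i> * of_real (real m * \<theta>)) ^ k / fact k))"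
      by (simp add: cis_conv_exp eval_nat_numeral algebra_simps)
    also have "\<dots> \<le> \<bar>real m * \<theta>\<bar> ^ Suc 2 / fact (Suc 2)" by (rule iexp_approx1)
    also have "\<dots> = real m ^ 3 * (\<bar>\<theta>\<bar> ^ 3 / 6)" by (simp add: eval_nat_numeral abs_mult)
    finally have "b m * exp (- (t * real m)) * norm (cis (real m * \<theta>) - 1 - \<i> * of_real (real m * \<theta>) + of_real ((real m * \<theta>)\<^sup>2 / 2))
        \<le> b m * exp (- (t * real m)) * (real m ^ 3 * (\<bar>\<theta>\<bar> ^ 3 / 6))"
      using b_nonneg by (intro mult_left_mono) auto
    moreover have "norm (of_real (b m * exp (- (t * real m))) :: complex) = b m * exp (- (t * real m))"
      using b_nonneg[of m] by (subst norm_of_real) simp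
    ultimately show ?thesis unfolding f_def norm_mult by (simp add: g_def mult_ac)
  qed
  have "norm (suminf f) \<le> suminf g" using g fg by (intro norm_suminf_le) (auto simp: sums_iff)
  then show ?thesis using f g by (simp add: sums_iff)
qed

lemma continuous_on_phase:
  assumes "t > 0"
  shows "continuous_on S (phase t)"
proof -
  have "continuous_on S (\<lambda>\<theta>. \<Phi> (of_real (exp (- t)) * cis \<theta>))"
    by (rule continuous_on_compose2[OF holomorphic_on_imp_continuous_on[OF Phi_holomorphic]])
       (use assms in \<open>auto intro!: continuous_intros simp: norm_mult simp del: of_real_exp\<close>)
  then show ?thesis unfolding phase_def by (intro continuous_intros)
qed

text \<open>The second factor is normalised to be near \<open>1\<close>:
  \<open>sqrt (moment 2 t / (2 * pi))\<close> is the reciprocal of the Gaussian integral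
  \<open>sqrt (2 * pi / moment 2 t)\<close>.\<close>

lemma coeff_eq_integral_phase:
  assumes t: "t > 0" and n: "real n = moment 1 t"
  shows "fps_nth (fps_expansion \<Psi> 0) n = saddle_main \<Psi> \<Phi> n (exp (- t)) *
     (of_real (sqrt (moment 2 t / (2 * pi))) * integral {-pi..pi} (\<lambda>\<theta>. exp (phase t \<theta>)))"
proof -
  let ?z = "complex_of_real (exp (- t))"
  have m2: "moment 2 t > 0"
  proof -
    have "0 \<le> moment 1 (2 * t)" unfolding moment_def
      by (intro suminf_nonneg summable_moment moment_term_nonneg) (use t in auto)
    also have "\<dots> < moment 1 t" using t by (intro moment_1_strict_antimono) auto
    also have "\<dots> \<le> moment 2 t" using moment_Suc_mono[OF t, of 1] by (simp add: numeral_2_eq_2)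
    finally show ?thesis .
  qed
  have eq: "\<Psi> (?z * cis \<theta>) * cis (- (real n * \<theta>)) = \<Psi> ?z * exp (phase t \<theta>)" for \<theta>
  proof -
    have "\<Psi> (?z * cis \<theta>) * cis (- (real n * \<theta>)) = exp (\<Phi> (?z * cis \<theta>)) * exp (- (\<i> * of_real (moment 1 t * \<theta>)))"
      using t n by (subst Psi_eq) (auto simp: norm_mult cis_conv_exp simp del: of_real_exp)
    also have "\<dots> = exp (\<Phi> ?z + phase t \<theta>)" by (simp add: phase_def flip: exp_add)
    also have "\<dots> = \<Psi> ?z * exp (phase t \<theta>)" using t by (subst Psi_eq) (auto simp: exp_add simp del: of_real_exp)
    finally show ?thesis .
  qed
  \<comment> \<open>The radicand is a nonnegative real, so the principal root is the real
    one.\<close>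
  have cs: "csqrt (2 * of_real pi * (euler_op ^^ 2) \<Phi> ?z) = of_real (sqrt (2 * pi * moment 2 t))"
  proof -
    have "2 * of_real pi * (euler_op ^^ 2) \<Phi> ?z = of_real (2 * pi * moment 2 t)"
      using euler_Phi_eq(2)[OF t] by (simp del: of_real_exp)
    moreover have "0 \<le> 2 * pi * moment 2 t" using m2 by simp
    ultimately show ?thesis by (simp only: of_real_sqrt)
  qed
  have sq: "sqrt (moment 2 t / (2 * pi)) / sqrt (2 * pi * moment 2 t) = 1 / (2 * pi)"
  proof -
    have "sqrt (moment 2 t / (2 * pi)) / sqrt (2 * pi * moment 2 t) = sqrt ((1 / (2 * pi))\<^sup>2)"
      using m2 by (subst real_sqrt_divide [symmetric]) (simp add: power2_eq_square field_simps)
    then show ?thesis by simp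
  qed
  have "fps_nth (fps_expansion \<Psi> 0) n = ?z powi (- int n) / (2 * of_real pi) *
      integral {-pi..pi} (\<lambda>\<theta>. \<Psi> ?z * exp (phase t \<theta>))"
    using fps_expansion_coeff_integral[OF Psi_holomorphic, of "exp (- t)" n] t eq by simp
  also have "\<dots> = ?z powi (- int n) * \<Psi> ?z * of_real (1 / (2 * pi)) * integral {-pi..pi} (\<lambda>\<theta>. exp (phase t \<theta>))"
    by simp
  also have "\<dots> = saddle_main \<Psi> \<Phi> n (exp (- t)) *
     (of_real (sqrt (moment 2 t / (2 * pi))) * integral {-pi..pi} (\<lambda>\<theta>. exp (phase t \<theta>)))"
    unfolding saddle_main_def cs sq [symmetric] by simp
  finally show ?thesis .
qed

text \<open>After normalisation the error is a combination of \<open>r\<close> and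
  \<open>r ^ 3\<close> for \<open>r = B / A powr (3/2)\<close>, plus a term exponentially small in
  \<open>t powr (-1/5)\<close>. The moment bounds give \<open>r\<close> the order
  \<open>t powr (445/1000)\<close> at most, so \<open>2/5\<close> absorbs the constants.\<close>

lemma saddle_relative_error:
  "eventually (\<lambda>t. norm (of_real (sqrt (moment 2 t / (2 * pi))) *
       integral {-pi..pi} (\<lambda>\<theta>. exp (phase t \<theta>)) - 1) \<le> t powr (2/5)) (at_right 0)"
proof -
  obtain K2 where K2: "K2 > 0" "eventually (\<lambda>t. K2 * t powr (- (99/100 * real (Suc 2))) \<le> moment 2 t) (at_right 0)"
    using moment_ge[of 2] by blast
  obtain L2 where L2: "L2 > 0" "\<And>t. 0 < t \<Longrightarrow> t \<le> 1 \<Longrightarrow> moment 2 t \<le> L2 * t powr (-(real 2 + 101/100))"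
    using moment_le[of 2] by blast
  obtain L3 where L3: "L3 > 0" "\<And>t. 0 < t \<Longrightarrow> t \<le> 1 \<Longrightarrow> moment 3 t \<le> L3 * t powr (-(real 3 + 101/100))"
    using moment_le[of 3] by blast
  obtain K where K: "K > 0" "eventually (\<lambda>t. \<forall>\<theta>. K * min (t powr (-29/10) * (int_dist (\<theta> / (2 * pi)))\<^sup>2) (t powr (-1/5))
      \<le> (\<Sum>m. b m * (1 - cos (real m * \<theta>)) * exp (- (t * real m)))) (at_right 0)"
    using minor_arc_bound by blast
  \<comment> \<open>\<open>Q * t powr (104/100)\<close> is a lower bound for the cutoff
    \<open>3 * A / (2 * B)\<close> divided by \<open>2 * pi\<close>.\<close>
  define Q where "Q = 3 * K2 / (2 * L3) / (2 * pi)"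
  have Q: "Q > 0" using K2 L3 by (simp add: Q_def)
  define R where "R t = L3 * t powr (-401/100) * (K2 * t powr (-297/100)) powr (-3/2)" for t :: real
  \<comment> \<open>From the cutoff on, the first argument of \<open>min\<close> in the minor arc
    bound is at least of order \<open>t powr (-82/100)\<close>, so the second one is the
    minimum.\<close>
  have "eventually (\<lambda>t. t powr (-29/10) * (Q * t powr (-297/100 + 401/100))\<^sup>2 \<ge> t powr (-1/5)) (at_right 0)"
    using Q by real_asymp
  moreover have "eventually (\<lambda>t. 16/6 * R t + 128/27 * R t ^ 3 + 2 * pi * (sqrt (L2 * t powr (-301/100)) * exp (- (K * t powr (-1/5))))
      \<le> t powr (2/5)) (at_right 0)"
    unfolding R_def using K K2(1) L2(1) L3(1) by real_asymp
  moreover have "eventually (\<lambda>t::real. 0 < t) (at_right 0)" by (rule eventually_at_right_less)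
  moreover have "eventually (\<lambda>t::real. t < 1) (at_right 0)" by (rule order_tendstoD) (auto intro: tendsto_ident_at)
  ultimately show ?thesis
    using K2(2) K(2)
  proof eventually_elim
    case (elim t)
    note e = elim
    define A where "A = moment 2 t"
    define B where "B = moment 3 t"
    have t: "t > 0" "t \<le> 1" using e by auto
    have A_ge: "A \<ge> K2 * t powr (-297/100)" using e by (simp add: A_def)
    have "K2 * t powr (-297/100) > 0" using K2 t by simp
    then have A: "A > 0" using A_ge by linarith
    have A_le: "A \<le> L2 * t powr (-301/100)" using L2(2)[OF t] by (simp add: A_def)
    have B_le: "B \<le> L3 * t powr (-401/100)" using L3(2)[OF t] by (simp add: B_def)
    have AB: "A \<le> B" using moment_Suc_mono[OF t(1), of 2] by (simp add: A_def B_def eval_nat_numeral)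
    then have B: "B > 0" using A by simp
    have est: "norm (integral {-pi..pi} (\<lambda>\<theta>. exp (phase t \<theta>)) - of_real (sqrt (2 * pi / A)))
           \<le> (B / 6 + (2 * B / (3 * A)) ^ 3) * (16 / A\<^sup>2) + 2 * pi * exp (- (K * t powr (-1/5)))"
    proof (rule saddle_integral_estimate[OF continuous_on_phase[OF t(1)] A AB])
      show "norm (phase t x + of_real (A * x\<^sup>2 / 2)) \<le> B * \<bar>x\<bar> ^ 3 / 6" for x
        unfolding A_def B_def by (rule phase_taylor[OF t(1)])
      fix x assume x: "\<bar>x\<bar> \<le> pi" "\<bar>x\<bar> > 3 * A / (2 * B)"
      have "\<bar>x / (2 * pi) - of_int 0\<bar> = \<bar>x\<bar> / (2 * pi)" by simp
      moreover have "\<bar>x\<bar> / (2 * pi) \<le> 1 / 2" using x by (simp add: field_simps)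
      ultimately have id: "int_dist (x / (2 * pi)) = \<bar>x\<bar> / (2 * pi)"
        using int_dist_eq[of "x / (2 * pi)" 0] by simp
      have "Q * t powr (-297/100 + 401/100) = 3 * (K2 * t powr (-297/100)) / (2 * (L3 * t powr (-401/100))) / (2 * pi)"
      proof -
        have "t powr (-297/100 + 401/100) = t powr (-297/100 - -401/100)" by simp
        also have "\<dots> = t powr (-297/100) / t powr (-401/100)" by (rule powr_diff)
        finally show ?thesis by (simp only: Q_def) (simp add: mult_ac)
      qed
      also have "\<dots> \<le> 3 * A / (2 * B) / (2 * pi)"
        using A_ge B_le A B L3 t by (intro divide_right_mono frac_le mult_left_mono) auto
      also have "\<dots> \<le> \<bar>x\<bar> / (2 * pi)" using x by (intro divide_right_mono) auto
      finally have "(Q * t powr (-297/100 + 401/100))\<^sup>2 \<le> (int_dist (x / (2 * pi)))\<^sup>2"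
        unfolding id using Q by (intro power_mono) auto
      then have "t powr (-29/10) * (Q * t powr (-297/100 + 401/100))\<^sup>2 \<le> t powr (-29/10) * (int_dist (x / (2 * pi)))\<^sup>2"
        by (intro mult_left_mono) auto
      then have "min (t powr (-29/10) * (int_dist (x / (2 * pi)))\<^sup>2) (t powr (-1/5)) = t powr (-1/5)"
        using e(1) by (intro min_absorb2) linarith
      moreover have "K * min (t powr (-29/10) * (int_dist (x / (2 * pi)))\<^sup>2) (t powr (-1/5)) \<le> - Re (phase t x)"
        unfolding Re_phase[OF t(1)] minus_minus using e by blast
      ultimately show "Re (phase t x) \<le> - (K * t powr (-1/5))" by simp
    qed
    define W where "W = sqrt (A / (2 * pi))"
    have W: "W \<ge> 0" "W * sqrt (2 * pi / A) = 1"
      using A by (auto simp: W_def simp flip: real_sqrt_mult)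
    have "2 * pi > 1" using pi_gt3 by linarith
    then have W_le: "W \<le> sqrt A" unfolding W_def using A by (intro real_sqrt_le_mono) (auto simp: field_simps)
    define r where "r = B * A powr (-3/2)"
    have sA: "sqrt A = A powr (1/2)" using A by (simp add: powr_half_sqrt)
    have A2: "A\<^sup>2 = A powr 2" using A by simp
    have r_le: "r \<le> R t"
      unfolding r_def R_def using A_ge B_le A B K2 L3 t by (intro mult_mono powr_mono2') auto
    have r0: "r \<ge> 0" using B by (simp add: r_def)
    have r1: "sqrt A * (B / A\<^sup>2) = r"
    proof -
      have "A powr (-3/2) = A powr (1/2 - 2)" by simp
      also have "\<dots> = A powr (1/2) / A\<^sup>2" unfolding A2 by (rule powr_diff)
      finally show ?thesis by (simp only: r_def sA) simp
    qed
    have r3: "sqrt A * ((B / A) ^ 3 / A\<^sup>2) = r ^ 3"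
    proof -
      have "r ^ 3 = B ^ 3 * A powr (-9/2)"
        unfolding r_def using A by (simp add: power_mult_distrib powr_power)
      moreover have "A powr (-9/2) = A powr (1/2) * A powr (-3) * A powr (-2)"
        by (simp add: powr_add [symmetric])
      moreover have "A powr (-3) = 1 / A ^ 3" "A powr (-2) = 1 / A ^ 2"
        using A by (simp_all add: powr_minus_divide)
      ultimately show ?thesis by (simp add: sA power_divide)
    qed
    have "of_real W * integral {-pi..pi} (\<lambda>\<theta>. exp (phase t \<theta>)) - 1 =
        of_real W * (integral {-pi..pi} (\<lambda>\<theta>. exp (phase t \<theta>)) - of_real (sqrt (2 * pi / A)))"
      using W(2) by (metis mult.commute of_real_1 of_real_mult right_diff_distrib')
    then have "norm (of_real W * integral {-pi..pi} (\<lambda>\<theta>. exp (phase t \<theta>)) - 1) =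
        W * norm (integral {-pi..pi} (\<lambda>\<theta>. exp (phase t \<theta>)) - of_real (sqrt (2 * pi / A)))"
      using W(1) by (simp add: norm_mult)
    also have "\<dots> \<le> sqrt A * ((B / 6 + (2 * B / (3 * A)) ^ 3) * (16 / A\<^sup>2) + 2 * pi * exp (- (K * t powr (-1/5))))"
      using W W_le est A by (intro mult_mono) auto
    also have "\<dots> = 16/6 * (sqrt A * (B / A\<^sup>2)) + 128/27 * (sqrt A * ((B / A) ^ 3 / A\<^sup>2)) + 2 * pi * (sqrt A * exp (- (K * t powr (-1/5))))"
    proof -
      have "(2 * B / (3 * A)) ^ 3 = 8/27 * (B / A) ^ 3" by (simp add: power_divide power_mult_distrib)
      then show ?thesis by (simp only: \<open>(2 * B / (3 * A)) ^ 3 = _\<close>) (simp add: algebra_simps)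
    qed
    also have "\<dots> = 16/6 * r + 128/27 * r ^ 3 + 2 * pi * (sqrt A * exp (- (K * t powr (-1/5))))"
      unfolding r1 r3 ..
    also have "\<dots> \<le> 16/6 * R t + 128/27 * R t ^ 3 + 2 * pi * (sqrt (L2 * t powr (-301/100)) * exp (- (K * t powr (-1/5))))"
      using r_le r0 A_le by (intro add_mono mult_left_mono mult_right_mono power_mono real_sqrt_le_mono) auto
    also have "\<dots> \<le> t powr (2/5)" using e by simp
    finally show ?case by (simp add: W_def A_def)
  qed
qed

text \<open>From \<open>n = moment 1 t \<le> L * t powr (-201/100)\<close>, the power
  \<open>t powr (201/600)\<close> is at most a constant times \<open>n powr (-1/6)\<close>, and
  \<open>2/5\<close> exceeds \<open>201/600\<close>.\<close>

theorem coeff_saddle_asymptotics: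
  assumes \<rho>: "eventually (\<lambda>n. saddle_point \<Phi> n (\<rho> n)) sequentially"
  shows "\<exists>E :: nat \<Rightarrow> complex. E \<in> O(\<lambda>n. complex_of_real (real n powr (-1/6))) \<and>
     eventually (\<lambda>n. fps_nth (fps_expansion \<Psi> 0) n = saddle_main \<Psi> \<Phi> n (\<rho> n) * (1 + E n)) sequentially"
proof -
  define t where "t n = - ln (\<rho> n)" for n
  define E where "E n = of_real (sqrt (moment 2 (t n) / (2 * pi))) *
       integral {-pi..pi} (\<lambda>\<theta>. exp (phase (t n) \<theta>)) - 1" for n
  have t: "eventually (\<lambda>n. t n > 0 \<and> \<rho> n = exp (- t n) \<and> real n = moment 1 (t n)) sequentially"
    using \<rho> by eventually_elim (auto simp: saddle_point_iff t_def)
  \<comment> \<open>A solution with \<open>t n \<ge> \<epsilon>\<close> forces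
    \<open>n \<le> moment 1 \<epsilon>\<close>, impossible for large \<open>n\<close>.\<close>
  have small: "eventually (\<lambda>n. t n < \<epsilon>) sequentially" if "\<epsilon> > 0" for \<epsilon>
  proof -
    have "eventually (\<lambda>n. real n > moment 1 \<epsilon>) sequentially"
      using filterlim_real_sequentially by (simp add: filterlim_at_top_dense)
    with t show ?thesis
    proof eventually_elim
      case (elim n)
      show ?case
      proof (rule ccontr)
        assume "\<not> t n < \<epsilon>"
        then have "moment 1 (t n) \<le> moment 1 \<epsilon>"
          using that moment_1_strict_antimono[of \<epsilon> "t n"] by (cases "t n = \<epsilon>") auto
        then show False using elim by simp
      qed
    qed
  qed
  have "filterlim t (at_right 0) sequentially"
    unfolding filterlim_at
  proof
    show "eventually (\<lambda>n. t n \<in> {0<..} \<and> t n \<noteq> 0) sequentially" using t by eventually_elim auto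
    show "t \<longlonglongrightarrow> 0"
    proof (rule order_tendstoI)
      fix a :: real assume "a < 0"
      then show "eventually (\<lambda>n. a < t n) sequentially" using t by (auto elim!: eventually_mono)
    qed (rule small)
  qed
  then have err: "eventually (\<lambda>n. norm (E n) \<le> t n powr (2/5)) sequentially"
    unfolding E_def by (rule eventually_compose_filterlim[OF saddle_relative_error])
  obtain L where L: "L > 0" "\<And>u. 0 < u \<Longrightarrow> u \<le> 1 \<Longrightarrow> moment 1 u \<le> L * u powr (-(real 1 + 101/100))"
    using moment_le[of 1] by blast
  have "eventually (\<lambda>n. norm (E n) \<le> L powr (1/6) * norm (complex_of_real (real n powr (-1/6)))) sequentially"
    using err t small[of 1, OF zero_less_one] eventually_gt_at_top[of 0]
  proof eventually_elim
    case (elim n)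
    define u where "u = t n"
    have u: "u > 0" "u \<le> 1" using elim by (auto simp: u_def)
    have "real n \<le> L * u powr (-201/100)" using L(2)[OF u] elim by (simp add: u_def)
    then have "(L * u powr (-201/100)) powr (-1/6) \<le> real n powr (-1/6)"
      using elim by (intro powr_mono2') auto
    also have "(L * u powr (-201/100)) powr (-1/6) = L powr (-1/6) * u powr (201/600)"
      using L u by (simp add: powr_mult powr_powr)
    finally have "L powr (1/6) * (L powr (-1/6) * u powr (201/600)) \<le> L powr (1/6) * real n powr (-1/6)"
      by (intro mult_left_mono) auto
    also have "L powr (1/6) * (L powr (-1/6) * u powr (201/600)) = u powr (201/600)"
      using L by (simp add: powr_add [symmetric] flip: mult.assoc)
    finally have "u powr (201/600) \<le> L powr (1/6) * real n powr (-1/6)" .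
    moreover have "u powr (2/5) \<le> u powr (201/600)" using u by (intro powr_mono') auto
    ultimately show ?case using elim by (simp add: u_def)
  qed
  then have "E \<in> O(\<lambda>n. complex_of_real (real n powr (-1/6)))" by (rule bigoI)
  moreover have "eventually (\<lambda>n. fps_nth (fps_expansion \<Psi> 0) n = saddle_main \<Psi> \<Phi> n (\<rho> n) * (1 + E n)) sequentially"
    using t by eventually_elim (use coeff_eq_integral_phase in \<open>auto simp: E_def\<close>)
  ultimately show ?thesis by blast
qed

end

section \<open>Logarithms of the Euler products\<close>

lemma ln_le_const_mult_powr:
  fixes x N :: real
  assumes "x > 0" "N > 0"
  shows "ln x \<le> N * x powr (1 / N)"
proof -
  have "ln (x powr (1 / N)) \<le> x powr (1 / N)"
    using assms ln_le_minus_one[of "x powr (1 / N)"] by simp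
  then show ?thesis using assms by (simp add: ln_powr field_simps)
qed

text \<open>The exponent \<open>1/200\<close> is half of the \<open>1/100\<close> allowed for the
  weights; the other half is kept for the harmonic sum inside \<open>log_coeff\<close>.\<close>

lemma ln_power_le_powr:
  "\<exists>D\<ge>0. \<forall>m::nat. m > 0 \<longrightarrow> (2 * ln (real m)) ^ r \<le> D * real m powr (1/200)"
proof (cases "r = 0")
  case True
  have "1 \<le> real m powr (1/200)" if "m > 0" for m :: nat
    using that by (intro ge_one_powr_ge_zero) auto
  then show ?thesis using True by (intro exI[of _ 1]) auto
next
  case False
  define N where "N = 200 * real r"
  have N: "N > 0" using False by (simp add: N_def)
  have "(2 * ln (real m)) ^ r \<le> (2 * N) ^ r * real m powr (1/200)" if m: "m > 0" for m :: nat
  proof -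
    have "(2 * ln (real m)) ^ r \<le> (2 * (N * real m powr (1 / N))) ^ r"
      using m N by (intro power_mono mult_left_mono ln_le_const_mult_powr) auto
    also have "\<dots> = (2 * N) ^ r * real m powr (1/200)"
      using m False by (simp add: power_mult_distrib powr_power N_def)
    finally show ?thesis .
  qed
  then show ?thesis using N by (intro exI[of _ "(2 * N) ^ r"]) auto
qed

text \<open>The coefficients of \<open>\<Sum>\<^sub>m - a m * Ln (1 - z ^ m)\<close>; the value at \<open>0\<close> is \<open>0\<close>, a sum over an
  infinite set.\<close>

definition log_coeff :: "(nat \<Rightarrow> real) \<Rightarrow> nat \<Rightarrow> real" where
  "log_coeff a k = (\<Sum>j | j dvd k. a (k div j) / real j)"

lemma div_pos_if_dvd: "(j::nat) dvd k \<Longrightarrow> k > 0 \<Longrightarrow> k div j > 0"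
  by (metis dvd_div_eq_0_iff neq0_conv)

lemma log_coeff_nonneg:
  assumes "\<And>m. m > 0 \<Longrightarrow> a m \<ge> 0"
  shows "log_coeff a k \<ge> 0"
proof (cases "k = 0")
  case False
  then show ?thesis unfolding log_coeff_def
    by (intro sum_nonneg divide_nonneg_nonneg assms div_pos_if_dvd) auto
qed (simp add: log_coeff_def)

lemma log_coeff_ge:
  assumes "\<And>m. m > 0 \<Longrightarrow> a m \<ge> 0" "k > 0"
  shows "a k \<le> log_coeff a k"
proof -
  have "a k = (\<Sum>j\<in>{1}. a (k div j) / real j)" by simp
  also have "\<dots> \<le> log_coeff a k"
    unfolding log_coeff_def
  proof (intro sum_mono2)
    fix j assume "j \<in> {j. j dvd k} - {1}"
    then have "k div j > 0" using assms(2) by (intro div_pos_if_dvd) auto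
    then show "0 \<le> a (k div j) / real j" using assms(1) by simp
  qed (use assms in auto)
  finally show ?thesis .
qed

text \<open>The sum of \<open>1 / j\<close> over divisors is at most a harmonic number, hence at
  most \<open>ln k + 1 \<le> (200 + 1) * k powr (1/200)\<close>.\<close>

lemma log_coeff_le:
  assumes a0: "\<And>m. m > 0 \<Longrightarrow> a m \<ge> 0" and D: "D \<ge> 0"
    and a_le: "\<And>m. m > 0 \<Longrightarrow> a m \<le> D * real m powr (1/200)"
  shows "log_coeff a k \<le> 201 * D * real k powr (1/100)"
proof (cases "k = 0")
  case False
  then have k: "k > 0" by simp
  have "log_coeff a k \<le> (\<Sum>j | j dvd k. D * real k powr (1/200) / real j)"
    unfolding log_coeff_def
  proof (intro sum_mono divide_right_mono)
    fix j assume "j \<in> {j. j dvd k}"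
    then have j: "k div j > 0" using k by (intro div_pos_if_dvd) auto
    have "a (k div j) \<le> D * real (k div j) powr (1/200)" by (rule a_le[OF j])
    also have "\<dots> \<le> D * real k powr (1/200)"
      using D by (intro mult_left_mono powr_mono2) auto
    finally show "a (k div j) \<le> D * real k powr (1/200)" .
  qed auto
  also have "\<dots> = D * real k powr (1/200) * (\<Sum>j | j dvd k. 1 / real j)" by (simp add: sum_distrib_left)
  also have "\<dots> \<le> D * real k powr (1/200) * (201 * real k powr (1/200))"
  proof (intro mult_left_mono)
    have "(\<Sum>j | j dvd k. 1 / real j) \<le> (\<Sum>j=1..k. 1 / real j)"
      using k by (intro sum_mono2 subsetI) (auto simp: Suc_le_eq intro: dvd_imp_le dvd_pos_nat)
    also have "\<dots> = harm k" by (simp add: harm_def inverse_eq_divide)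
    also have "harm k \<le> ln (real k) + 1"
      using decseqD[OF decseq_harm_diff_ln, of 0 "k - 1"] k by (simp add: harm_def)
    also have "\<dots> \<le> 201 * real k powr (1/200)"
      using ln_le_const_mult_powr[of "real k" 200] k ge_one_powr_ge_zero[of "real k" "1/200"] by simp
    finally show "(\<Sum>j | j dvd k. 1 / real j) \<le> 201 * real k powr (1/200)" .
  qed (use D in auto)
  also have "\<dots> = 201 * D * real k powr (1/100)"
    using k by (simp add: powr_add [symmetric])
  finally show ?thesis .
qed (simp add: log_coeff_def)

lemma has_sum_Suc_iff:
  fixes h :: "nat \<Rightarrow> complex"
  assumes "h 0 = 0"
  shows "((\<lambda>m. h (Suc m)) has_sum S) UNIV \<longleftrightarrow> (h has_sum S) UNIV"
proof -
  have "(h has_sum S) UNIV \<longleftrightarrow> (h has_sum S) (range Suc)"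
  proof (intro has_sum_cong_neutral)
    fix m :: nat assume "m \<in> UNIV - range Suc"
    then show "h m = 0" using assms by (cases m) auto
  qed auto
  also have "\<dots> \<longleftrightarrow> ((h \<circ> Suc) has_sum S) UNIV" by (intro has_sum_reindex) auto
  finally show ?thesis by (simp add: o_def)
qed

text \<open>Over \<open>complex\<close>, summable means absolutely summable, and the norms over a
  fibre add up to its cardinality times one value; so summability lifts from the natural numbers to
  \<open>A\<close>.\<close>

lemma has_sum_group_finite:
  fixes g :: "nat \<Rightarrow> complex" and f :: "'a \<Rightarrow> nat"
  assumes fin: "\<And>m. finite {x\<in>A. f x = m}"
    and sum: "((\<lambda>m. of_nat (card {x\<in>A. f x = m}) * g m) has_sum S) UNIV"
  shows "((\<lambda>x. g (f x)) has_sum S) A"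
proof -
  define F where "F m = {x\<in>A. f x = m}" for m
  have bij: "bij_betw snd (Sigma UNIV F) A"
    by (rule bij_betwI[of _ _ _ "\<lambda>x. (f x, x)"]) (auto simp: F_def)
  have "(\<lambda>m. norm (of_nat (card (F m)) * g m)) summable_on UNIV"
    using has_sum_imp_summable[OF sum] unfolding F_def
    by (rule summable_on_iff_abs_summable_on_complex[THEN iffD1])
  then have "(\<lambda>p. norm (g (fst p))) summable_on Sigma UNIV F"
    unfolding Infinite_Sum.abs_summable_on_Sigma_iff using fin by (simp add: F_def norm_mult)
  then have sm: "(\<lambda>p. g (fst p)) summable_on Sigma UNIV F" by (rule Infinite_Sum.abs_summable_summable)
  have "infsum (\<lambda>p. g (fst p)) (Sigma UNIV F) = (\<Sum>\<^sub>\<infinity>m. \<Sum>\<^sub>\<infinity>x\<in>F m. g (fst (m, x)))"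
    by (rule infsum_Sigma_banach [symmetric]) (rule sm)
  also have "\<dots> = (\<Sum>\<^sub>\<infinity>m. of_nat (card (F m)) * g m)" using fin by (simp add: F_def)
  also have "\<dots> = S" using sum by (simp add: F_def infsumI)
  finally have "((\<lambda>p. g (fst p)) has_sum S) (Sigma UNIV F)"
    using sm by (metis has_sum_infsum)
  also have "?this \<longleftrightarrow> ((\<lambda>p. g (f (snd p))) has_sum S) (Sigma UNIV F)"
    by (intro has_sum_cong) (auto simp: F_def)
  also have "\<dots> \<longleftrightarrow> ((\<lambda>x. g (f x)) has_sum S) A"
    by (rule has_sum_reindex_bij_betw[OF bij])
  finally show ?thesis .
qed

lemma minus_Ln_series:
  assumes "norm w < 1"
  shows "(\<lambda>j. w ^ Suc j / of_nat (Suc j)) sums (- Ln (1 - w))"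
proof -
  have "(\<lambda>n. - ((- (- w)) ^ n) / of_nat n) sums ln (1 + (- w))" by (rule Ln_series') (use assms in simp)
  from sums_minus[OF this] have "(\<lambda>n. w ^ n / of_nat n) sums (- Ln (1 - w))" by simp
  then show ?thesis using sums_Suc_iff[of "\<lambda>n. w ^ n / of_nat n"] by simp
qed

text \<open>One absolutely convergent double series, with terms \<open>a m / j * z ^ (j * m)\<close>
  for \<open>j, m \<ge> 1\<close>, is summed in three orders: along \<open>j * m = k\<close> as a
  power series, by rows \<open>j\<close> as the series defining \<open>Phi_P\<close> and
  \<open>Phi_L\<close>, and by columns \<open>m\<close> as the logarithm of the Euler
  product.\<close>

lemma log_series:
  fixes a :: "nat \<Rightarrow> real" and z :: complex
  assumes a0: "\<And>m. m > 0 \<Longrightarrow> a m \<ge> 0" and z: "norm z < 1"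
    and sm: "summable (\<lambda>k. log_coeff a k * norm z ^ k)"
  defines "S \<equiv> (\<Sum>k. of_real (log_coeff a k) * z ^ k)"
  shows "(\<lambda>k. of_real (log_coeff a k) * z ^ k) sums S"
    and "(\<lambda>m. of_real (a (Suc m)) * z ^ (Suc j * Suc m)) summable_on UNIV"
    and "(\<lambda>j. 1 / of_nat (Suc j) * (\<Sum>\<^sub>\<infinity>m. of_real (a (Suc m)) * z ^ (Suc j * Suc m))) sums S"
    and "((\<lambda>m. - (of_real (a (Suc m)) * Ln (1 - z ^ Suc m))) has_sum S) UNIV"
proof -
  \<comment> \<open>Index \<open>0\<close> is left out because its set of divisors is infinite. The
    map \<open>g\<close> carries pairs \<open>(j, m)\<close>, both shifted by one, bijectively onto
    these \<open>(k, j)\<close>.\<close>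
  define D where "D = Sigma {0<..} (\<lambda>k::nat. {j. j dvd k})"
  define G where "G = (\<lambda>(k, j). of_real (a (k div j) / real j) * z ^ k)"
  define F where "F = (\<lambda>(j, m). of_real (a (Suc m) / real (Suc j)) * z ^ (Suc j * Suc m))"
  define g where "g = (\<lambda>(j, m). (Suc j * Suc m, Suc j))"
  have b0: "log_coeff a k \<ge> 0" for k using a0 by (rule log_coeff_nonneg)
  have nb: "summable (\<lambda>k. norm (of_real (log_coeff a k) * z ^ k))"
    using sm b0 by (simp add: norm_mult norm_power)
  then show bs: "(\<lambda>k. of_real (log_coeff a k) * z ^ k) sums S"
    unfolding S_def by (rule summable_sums[OF summable_norm_cancel])
  have bS: "((\<lambda>k. of_real (log_coeff a k) * z ^ k) has_sum S) UNIV"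
    using nb bs by (rule norm_summable_imp_has_sum)
  have inner: "(\<Sum>j | j dvd k. G (k, j)) = of_real (log_coeff a k) * z ^ k" for k
    by (simp add: G_def log_coeff_def sum_distrib_right)
  have inner_norm: "(\<Sum>j | j dvd k. norm (G (k, j))) = norm (of_real (log_coeff a k) * z ^ k)" if "k > 0" for k
  proof -
    have "(\<Sum>j | j dvd k. norm (G (k, j))) = (\<Sum>j | j dvd k. a (k div j) / real j * norm z ^ k)"
      using that a0 by (intro sum.cong) (auto simp: G_def norm_mult norm_power norm_divide dvd_div_eq_0_iff abs_of_nonneg)
    also have "\<dots> = log_coeff a k * norm z ^ k" by (simp add: log_coeff_def sum_distrib_right)
    also have "\<dots> = norm (of_real (log_coeff a k) * z ^ k)"
      using b0[of k] by (simp add: norm_mult norm_power)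
    finally show ?thesis .
  qed
  have fin: "finite {j. j dvd k}" if "k > 0" for k :: nat using that by simp
  have "(\<lambda>k. norm (of_real (log_coeff a k) * z ^ k)) summable_on {0<..}"
    using norm_summable_imp_summable_on[of "\<lambda>k. norm (of_real (log_coeff a k) * z ^ k)"] nb
    by (auto intro: summable_on_subset_banach)
  then have "(\<lambda>k. norm (\<Sum>\<^sub>\<infinity>j\<in>{j. j dvd k}. norm (G (k, j)))) summable_on {0<..}"
    by (rule summable_on_cong[THEN iffD1, rotated]) (simp add: fin inner_norm)
  then have "(\<lambda>x. norm (G x)) summable_on D"
    unfolding D_def Infinite_Sum.abs_summable_on_Sigma_iff
    by (intro conjI ballI) (simp_all only: summable_on_finite fin greaterThan_iff)
  then have GD: "G summable_on D" by (rule Infinite_Sum.abs_summable_summable)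
  have "infsum G D = (\<Sum>\<^sub>\<infinity>k\<in>{0<..}. \<Sum>\<^sub>\<infinity>j\<in>{j. j dvd k}. G (k, j))"
    using GD unfolding D_def by (rule infsum_Sigma_banach [symmetric])
  also have "\<dots> = (\<Sum>\<^sub>\<infinity>k\<in>{0<..}. of_real (log_coeff a k) * z ^ k)"
    by (intro infsum_cong) (simp add: fin inner)
  also have "\<dots> = (\<Sum>\<^sub>\<infinity>k. of_real (log_coeff a k) * z ^ k)"
    by (intro infsum_cong_neutral) (auto simp: log_coeff_def)
  also have "\<dots> = S" using bS by (rule infsumI)
  finally have GS: "(G has_sum S) D" using GD by (metis has_sum_infsum)
  have bij: "bij_betw g (UNIV \<times> UNIV) D"
  proof (rule bij_betwI[of _ _ _ "\<lambda>(k, j). (j - 1, k div j - 1)"])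
    show "g \<in> UNIV \<times> UNIV \<rightarrow> D" by (auto simp: g_def D_def simp del: mult_Suc mult_Suc_right)
    fix x assume "x \<in> D"
    then obtain k j where kj: "x = (k, j)" "k > 0" "j dvd k" by (auto simp: D_def)
    then have "j > 0" "k div j > 0" by (auto intro: div_pos_if_dvd dvd_pos_nat)
    then show "g (case x of (k, j) \<Rightarrow> (j - 1, k div j - 1)) = x" using kj by (simp add: g_def del: mult_Suc mult_Suc_right)
  qed (auto simp: g_def simp del: mult_Suc mult_Suc_right)
  have "F = (\<lambda>x. G (g x))" by (auto simp: F_def G_def g_def simp del: mult_Suc mult_Suc_right)
  then have FS: "(F has_sum S) (UNIV \<times> UNIV)"
    using GS has_sum_reindex_bij_betw[OF bij, of G S] by simp
  then have Fs: "F summable_on (UNIV \<times> UNIV)" by (rule has_sum_imp_summable)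
  have Fj: "(\<lambda>m. F (j, m)) summable_on UNIV" for j
    using summable_on_SigmaD1[of "\<lambda>j m. F (j, m)" UNIV "\<lambda>_. UNIV" j] Fs by simp
  have row: "(\<lambda>m. of_real (a (Suc m)) * z ^ (Suc j * Suc m)) = (\<lambda>m. of_nat (Suc j) * F (j, m))" for j
    by (simp add: F_def del: mult_Suc of_nat_Suc)
  show "(\<lambda>m. of_real (a (Suc m)) * z ^ (Suc j * Suc m)) summable_on UNIV"
    unfolding row by (intro summable_on_cmult_right Fj)
  have "((\<lambda>j. \<Sum>\<^sub>\<infinity>m. F (j, m)) has_sum S) UNIV"
    using FS by (rule has_sum_SigmaD) (use Fj in auto)
  then have "(\<lambda>j. \<Sum>\<^sub>\<infinity>m. F (j, m)) sums S" by (rule has_sum_imp_sums)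
  moreover have "(\<Sum>\<^sub>\<infinity>m. F (j, m)) = 1 / of_nat (Suc j) * (\<Sum>\<^sub>\<infinity>m. of_real (a (Suc m)) * z ^ (Suc j * Suc m))" for j
    unfolding row by (subst infsum_cmult_right) (auto intro: Fj simp del: of_nat_Suc)
  ultimately show "(\<lambda>j. 1 / of_nat (Suc j) * (\<Sum>\<^sub>\<infinity>m. of_real (a (Suc m)) * z ^ (Suc j * Suc m))) sums S"
    by simp
  have FS': "((\<lambda>(m, j). F (j, m)) has_sum S) (UNIV \<times> UNIV)"
    using FS has_sum_swap[of F UNIV UNIV S] by simp
  have col: "((\<lambda>j. F (j, m)) has_sum (- (of_real (a (Suc m)) * Ln (1 - z ^ Suc m)))) UNIV" for m
  proof -
    have w: "norm (z ^ Suc m) < 1" using z by (simp add: norm_power power_less_one_iff del: power_Suc)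
    have "(\<lambda>j. of_real (a (Suc m)) * ((z ^ Suc m) ^ Suc j / of_nat (Suc j))) sums (of_real (a (Suc m)) * (- Ln (1 - z ^ Suc m)))"
      by (intro sums_mult minus_Ln_series w)
    also have "(\<lambda>j. of_real (a (Suc m)) * ((z ^ Suc m) ^ Suc j / of_nat (Suc j))) = (\<lambda>j. F (j, m))"
      by (simp add: F_def mult.commute flip: power_mult del: mult_Suc power_Suc of_nat_Suc)
    finally have 1: "(\<lambda>j. F (j, m)) sums (of_real (a (Suc m)) * (- Ln (1 - z ^ Suc m)))" .
    have "(\<lambda>j. F (j, m)) summable_on UNIV"
      using summable_on_SigmaD1[OF has_sum_imp_summable[OF FS'], of m] by simp
    then have "((\<lambda>j. F (j, m)) has_sum infsum (\<lambda>j. F (j, m)) UNIV) UNIV" by (rule has_sum_infsum)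
    then show ?thesis using 1 has_sum_imp_sums sums_unique2 by (metis mult_minus_right)
  qed
  show "((\<lambda>m. - (of_real (a (Suc m)) * Ln (1 - z ^ Suc m))) has_sum S) UNIV"
    using FS' by (rule has_sum_SigmaD) (use col in auto)
qed

text \<open>The term \<open>j = 1\<close> of \<open>log_coeff\<close> passes lower bounds for
  \<open>a\<close> on unchanged. In both applications \<open>r = Suc e\<close>, so that
  \<open>2 ^ e * p\<close> and \<open>3 ^ e * p\<close> are products of exactly \<open>r\<close>
  primes.\<close>

lemma prime_dominated_log_coeff:
  assumes a0: "\<And>m. m > 0 \<Longrightarrow> a m \<ge> 0"
    and a_le: "\<And>m. m > 0 \<Longrightarrow> a m \<le> (2 * ln (real m)) ^ r"
    and c: "c > 0" "\<And>p. prime p \<Longrightarrow> c \<le> a (2 ^ e * p)" "\<And>p. prime p \<Longrightarrow> c \<le> a (3 ^ e * p)"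
  shows "\<exists>C. prime_dominated_weights (log_coeff a) C c (2 ^ e) (3 ^ e)"
proof -
  obtain D where D: "D \<ge> 0" "\<And>m::nat. m > 0 \<Longrightarrow> (2 * ln (real m)) ^ r \<le> D * real m powr (1/200)"
    using ln_power_le_powr[of r] by blast
  have "prime_dominated_weights (log_coeff a) (201 * D) c (2 ^ e) (3 ^ e)"
  proof
    show "0 \<le> log_coeff a k" for k using a0 by (rule log_coeff_nonneg)
    show "log_coeff a k \<le> 201 * D * real k powr (1/100)" for k
      using a0 D(1) by (rule log_coeff_le) (use a_le D(2) order.trans in blast)+
    show "coprime (2 ^ e) (3 ^ e :: nat)" by simp
    show "c \<le> log_coeff a (2 ^ e * p)" if "prime p" for p
      using c(2)[OF that] log_coeff_ge[of a "2 ^ e * p", OF a0] prime_gt_0_nat[OF that] by simp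
    show "c \<le> log_coeff a (3 ^ e * p)" if "prime p" for p
      using c(3)[OF that] log_coeff_ge[of a "3 ^ e * p", OF a0] prime_gt_0_nat[OF that] by simp
  qed (rule c)
  then show ?thesis by blast
qed

lemma infsum_eq_suminf:
  fixes f :: "nat \<Rightarrow> complex"
  assumes "f summable_on UNIV"
  shows "infsum f UNIV = suminf f"
  using has_sum_imp_sums[OF has_sum_infsum[OF assms]] by (simp add: sums_iff)

section \<open>Bounds for iterated convolutions of the von Mangoldt function\<close>

lemma mangoldt_conv_nonneg: "mangoldt_conv r m \<ge> 0"
proof (induction r arbitrary: m)
  case (Suc r)
  then show ?case by (auto simp: dirichlet_conv_def intro!: sum_nonneg mult_nonneg_nonneg mangoldt_nonneg)
qed simp

text \<open>\<open>mangoldt\<close> sums to \<open>ln m\<close> over the divisors of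
  \<open>m\<close>, so each convolution costs one factor \<open>ln m\<close>.\<close>

lemma mangoldt_conv_le:
  assumes "m > 0"
  shows "mangoldt_conv r m \<le> ln (real m) ^ r"
  using assms
proof (induction r arbitrary: m)
  case (Suc r)
  have "mangoldt_conv (Suc r) m \<le> (\<Sum>d | d dvd m. mangoldt d * ln (real m) ^ r)"
    unfolding mangoldt_conv.simps dirichlet_conv_def
  proof (intro sum_mono mult_left_mono mangoldt_nonneg)
    fix d assume "d \<in> {d. d dvd m}"
    then have pos: "m div d > 0" using Suc.prems by (intro div_pos_if_dvd) auto
    have "mangoldt_conv r (m div d) \<le> ln (real (m div d)) ^ r" by (rule Suc.IH[OF pos])
    also have "\<dots> \<le> ln (real m) ^ r"
      using pos Suc.prems by (intro power_mono) (auto simp: Suc_le_eq)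
    finally show "mangoldt_conv r (m div d) \<le> ln (real m) ^ r" .
  qed
  also have "\<dots> = ln (real m) * ln (real m) ^ r"
    using Suc.prems by (simp add: mangoldt_sum flip: sum_distrib_right)
  finally show ?case by simp
qed simp

lemma mangoldt_conv_Suc_ge:
  assumes "d > 0" "m > 0"
  shows "mangoldt d * mangoldt_conv r m \<le> mangoldt_conv (Suc r) (d * m)"
proof -
  have "mangoldt d * mangoldt_conv r m = (\<Sum>k\<in>{d}. mangoldt k * mangoldt_conv r (d * m div k))"
    using assms by simp
  also have "\<dots> \<le> mangoldt_conv (Suc r) (d * m)"
    unfolding mangoldt_conv.simps dirichlet_conv_def using assms
    by (intro sum_mono2) (auto intro!: mult_nonneg_nonneg mangoldt_nonneg mangoldt_conv_nonneg)
  finally show ?thesis .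
qed

text \<open>Keeping a single divisor in each convolution, \<open>q\<close> for \<open>e\<close>
  times and then \<open>p\<close>, leaves \<open>ln q ^ e * ln p\<close>.\<close>

lemma mangoldt_conv_prime_ge:
  assumes q: "prime q" and p: "prime p"
  shows "ln 2 ^ Suc e \<le> mangoldt_conv (Suc e) (q ^ e * p)"
proof (induction e)
  case 0
  have "ln 2 \<le> mangoldt p * mangoldt_conv 0 1" using prime_ge_2_nat[OF p] p by simp
  also have "\<dots> \<le> mangoldt_conv (Suc 0) (p * 1)"
    using prime_gt_0_nat[OF p] by (intro mangoldt_conv_Suc_ge) auto
  finally show ?case by simp
next
  case (Suc e)
  have "ln 2 ^ Suc (Suc e) \<le> mangoldt q * mangoldt_conv (Suc e) (q ^ e * p)"
    using Suc.IH q prime_ge_2_nat[OF q] unfolding power_Suc[of _ "Suc e"] by (intro mult_mono) auto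
  also have "\<dots> \<le> mangoldt_conv (Suc (Suc e)) (q * (q ^ e * p))"
    using prime_gt_0_nat[OF p] prime_gt_0_nat[OF q] by (intro mangoldt_conv_Suc_ge) auto
  finally show ?case by (simp only: power_Suc mult.assoc)
qed

lemma exp_series_L:
  assumes "r \<ge> 1"
  shows "\<exists>C c s s'. exp_series (log_coeff (mangoldt_conv r)) C c s s' (Phi_L r) (Psi_L r)"
proof -
  let ?a = "mangoldt_conv r"
  obtain e where e: "r = Suc e" using assms by (cases r) auto
  have le: "?a m \<le> (2 * ln (real m)) ^ r" if "m > 0" for m
  proof -
    have "ln (real m) ^ r \<le> (2 * ln (real m)) ^ r" using that by (intro power_mono) auto
    then show ?thesis using mangoldt_conv_le[OF that, of r] by simp
  qed
  have p3: "prime (3::nat)" by simp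
  have "\<exists>C. prime_dominated_weights (log_coeff ?a) C (ln 2 ^ Suc e) (2 ^ e) (3 ^ e)"
  proof (rule prime_dominated_log_coeff[where r = r])
    show "ln 2 ^ Suc e \<le> ?a (2 ^ e * p)" if "prime p" for p
      unfolding e by (rule mangoldt_conv_prime_ge[OF two_is_prime_nat that])
    show "ln 2 ^ Suc e \<le> ?a (3 ^ e * p)" if "prime p" for p
      unfolding e by (rule mangoldt_conv_prime_ge[OF p3 that])
  qed (use mangoldt_conv_nonneg le in auto)
  then obtain C where "prime_dominated_weights (log_coeff ?a) C (ln 2 ^ Suc e) (2 ^ e) (3 ^ e)" by blast
  then interpret W: prime_dominated_weights "log_coeff ?a" C "ln 2 ^ Suc e" "2 ^ e" "3 ^ e" .
  have "exp_series (log_coeff ?a) C (ln 2 ^ Suc e) (2 ^ e) (3 ^ e) (Phi_L r) (Psi_L r)"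
  proof
    fix z :: complex assume z: "norm z < 1"
    have sm: "summable (\<lambda>k. log_coeff ?a k * norm z ^ k)" using z by (intro W.summable_b) auto
    note ls = log_series[of ?a z, OF mangoldt_conv_nonneg z sm]
    have Phi: "Phi_L r z = (\<Sum>k. of_real (log_coeff ?a k) * z ^ k)"
      unfolding Phi_L_def using sums_unique[OF ls(3)] ls(2) by (simp add: infsum_eq_suminf del: mult_Suc of_nat_Suc)
    then show "(\<lambda>k. of_real (log_coeff ?a k) * z ^ k) sums Phi_L r z" using ls(1) by simp
    have "(\<lambda>m. - (of_real (?a (Suc m)) * Ln (1 - z ^ Suc m))) sums Phi_L r z"
      using ls(4) unfolding Phi by (rule has_sum_imp_sums)
    moreover have "(1 - z ^ Suc m) powr (- of_real (?a (Suc m))) = exp (- (of_real (?a (Suc m)) * Ln (1 - z ^ Suc m)))" for m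
    proof -
      have "norm (z ^ Suc m) < 1" using z by (simp add: norm_power power_less_one_iff del: power_Suc)
      then have "1 - z ^ Suc m \<noteq> 0" by auto
      then show ?thesis by (simp add: powr_def)
    qed
    ultimately show "Psi_L r z = exp (Phi_L r z)"
      unfolding Psi_L_def by (simp add: prodinf_exp sums_iff)
  qed
  then show ?thesis by blast
qed

section \<open>Counting ordered prime tuples by their product\<close>

definition tuple_count :: "nat \<Rightarrow> nat \<Rightarrow> nat" where
  "tuple_count r m = card {ps \<in> prime_tuples r. prod_list ps = m}"

lemma prime_tuples_prod_pos: "ps \<in> prime_tuples r \<Longrightarrow> prod_list ps > 0"
  by (metis (mono_tags, lifting) mem_Collect_eq neq0_conv not_prime_0 prime_tuples_def prod_list_zero_iff)

lemma prime_tuples_prod_subset: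
  assumes "m > 0"
  shows "{ps \<in> prime_tuples r. prod_list ps = m} \<subseteq> {ps. set ps \<subseteq> prime_factors m \<and> length ps = r}"
  using assms by (auto simp: prime_tuples_def in_prime_factors_iff prod_list_dvd)

lemma finite_prime_tuples_prod: "finite {ps \<in> prime_tuples r. prod_list ps = m}"
proof (cases "m = 0")
  case True
  then have "{ps \<in> prime_tuples r. prod_list ps = m} = {}" using prime_tuples_prod_pos by force
  then show ?thesis by (simp only: finite.emptyI)
next
  case False
  then show ?thesis
    by (intro finite_subset[OF prime_tuples_prod_subset] finite_lists_length_eq) auto
qed

text \<open>Each distinct prime factor contributes at least \<open>2\<close> to the product
  \<open>m\<close>, and \<open>1 / ln 2 \<le> 2\<close>. This is the origin of the \<open>2\<close>
  in the common bound \<open>(2 * ln m) ^ r\<close>.\<close>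

lemma card_prime_factors_le_ln:
  assumes "m > 0"
  shows "real (card (prime_factors m)) \<le> 2 * ln (real m)"
proof -
  have "2 ^ card (prime_factors m) = (\<Prod>p\<in>prime_factors m. 2::nat)" by simp
  also have "\<dots> \<le> (\<Prod>p\<in>prime_factors m. p ^ multiplicity p m)"
  proof (intro prod_mono conjI)
    fix p assume p: "p \<in> prime_factors m"
    then have "2 \<le> p" "multiplicity p m > 0"
      by (auto simp: in_prime_factors_iff prime_ge_2_nat prime_multiplicity_gt_zero_iff assms)
    then show "2 \<le> p ^ multiplicity p m" using self_le_power[of p "multiplicity p m"] by linarith
  qed auto
  also have "\<dots> = m" using prime_factorization_nat[of m] assms by simp
  finally have "2 ^ card (prime_factors m) \<le> real m" by (simp flip: of_nat_le_iff)
  then have "ln (2 ^ card (prime_factors m)) \<le> ln (real m)" using assms by (subst ln_le_cancel_iff) auto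
  then have "real (card (prime_factors m)) * ln 2 \<le> ln (real m)" by (simp add: ln_realpow)
  moreover have "real (card (prime_factors m)) * (1/2) \<le> real (card (prime_factors m)) * ln 2"
    using ln2_ge_two_thirds by (intro mult_left_mono) auto
  ultimately show ?thesis by linarith
qed

lemma tuple_count_le:
  assumes "m > 0"
  shows "real (tuple_count r m) \<le> (2 * ln (real m)) ^ r"
proof -
  have "tuple_count r m \<le> card {ps. set ps \<subseteq> prime_factors m \<and> length ps = r}"
    unfolding tuple_count_def
    by (intro card_mono finite_lists_length_eq prime_tuples_prod_subset assms) auto
  also have "\<dots> = card (prime_factors m) ^ r" by (intro card_lists_length_eq) auto
  finally have "real (tuple_count r m) \<le> real (card (prime_factors m)) ^ r" by (simp flip: of_nat_power)
  also have "\<dots> \<le> (2 * ln (real m)) ^ r" using card_prime_factors_le_ln[OF assms] by (intro power_mono) auto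
  finally show ?thesis .
qed

lemma tuple_count_prime_ge:
  assumes "prime q" "prime p"
  shows "1 \<le> real (tuple_count (Suc e) (q ^ e * p))"
proof -
  have "replicate e q @ [p] \<in> {ps \<in> prime_tuples (Suc e). prod_list ps = q ^ e * p}"
    using assms by (auto simp: prime_tuples_def prod_list_replicate)
  then have "tuple_count (Suc e) (q ^ e * p) \<noteq> 0"
    unfolding tuple_count_def using finite_prime_tuples_prod[of "Suc e" "q ^ e * p"] by auto
  then show ?thesis by simp
qed

lemma has_sum_prime_tuples:
  fixes g :: "nat \<Rightarrow> complex"
  assumes "((\<lambda>m. of_nat (tuple_count r (Suc m)) * g (Suc m)) has_sum S) UNIV"
  shows "((\<lambda>ps. g (prod_list ps)) has_sum S) (prime_tuples r)"
proof (rule has_sum_group_finite[where f = prod_list and g = g and A = "prime_tuples r", OF finite_prime_tuples_prod])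
  have "{ps \<in> prime_tuples r. prod_list ps = 0} = {}" using prime_tuples_prod_pos by force
  then have "tuple_count r 0 = 0" by (simp only: tuple_count_def card.empty)
  then have "((\<lambda>m. of_nat (tuple_count r m) * g m) has_sum S) UNIV"
    using assms has_sum_Suc_iff[of "\<lambda>m. of_nat (tuple_count r m) * g m" S] by simp
  then show "((\<lambda>m. of_nat (card {ps \<in> prime_tuples r. prod_list ps = m}) * g m) has_sum S) UNIV"
    by (simp add: tuple_count_def)
qed

lemma exp_series_P:
  assumes "r \<ge> 1"
  shows "\<exists>C c s s'. exp_series (log_coeff (tuple_count r)) C c s s' (Phi_P r) (Psi_P r)"
proof -
  define a where "a m = real (tuple_count r m)" for m
  obtain e where e: "r = Suc e" using assms by (cases r) auto
  have p3: "prime (3::nat)" by simp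
  have "\<exists>C. prime_dominated_weights (log_coeff a) C 1 (2 ^ e) (3 ^ e)"
    using tuple_count_le[of _ r] tuple_count_prime_ge[OF two_is_prime_nat, of _ e] tuple_count_prime_ge[OF p3, of _ e]
    unfolding a_def e by (intro prime_dominated_log_coeff[of _ "Suc e"]) auto
  then obtain C where "prime_dominated_weights (log_coeff a) C 1 (2 ^ e) (3 ^ e)" by blast
  then interpret W: prime_dominated_weights "log_coeff a" C 1 "2 ^ e" "3 ^ e" .
  have "exp_series (log_coeff a) C 1 (2 ^ e) (3 ^ e) (Phi_P r) (Psi_P r)"
  proof
    fix z :: complex assume z: "norm z < 1"
    have sm: "summable (\<lambda>k. log_coeff a k * norm z ^ k)" using z by (intro W.summable_b) auto
    have a0: "a m \<ge> 0" for m by (simp add: a_def)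
    note ls = log_series[of a z, OF a0 z sm]
    have inner: "(\<Sum>\<^sub>\<infinity>ps\<in>prime_tuples r. z ^ (Suc j * prod_list ps)) =
        (\<Sum>\<^sub>\<infinity>m. of_real (a (Suc m)) * z ^ (Suc j * Suc m))" for j
      using has_sum_prime_tuples[of r "\<lambda>m. z ^ (Suc j * m)"] has_sum_infsum[OF ls(2)[of j]]
      by (intro infsumI) (simp add: a_def del: mult_Suc mult_Suc_right)
    have Phi: "Phi_P r z = (\<Sum>k. of_real (log_coeff a k) * z ^ k)"
      unfolding Phi_P_def inner by (rule sums_unique [symmetric]) (rule ls(3))
    then show "(\<lambda>k. of_real (log_coeff a k) * z ^ k) sums Phi_P r z" using ls(1) by simp
    have "((\<lambda>m. of_nat (tuple_count r (Suc m)) * - Ln (1 - z ^ Suc m)) has_sum Phi_P r z) UNIV"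
      using ls(4) unfolding Phi by (simp add: a_def)
    \<comment> \<open>\<open>Psi_P\<close> is a limit along finite subsets, the same filter as in
      \<open>has_sum\<close>, so continuity of \<open>exp\<close> turns the sum of logarithms into
      the product.\<close>
    from has_sum_prime_tuples[OF this]
    have "((\<lambda>X. \<Sum>ps\<in>X. - Ln (1 - z ^ prod_list ps)) \<longlongrightarrow> Phi_P r z) (finite_subsets_at_top (prime_tuples r))"
      by (simp add: has_sum_def)
    then have "((\<lambda>X. exp (\<Sum>ps\<in>X. - Ln (1 - z ^ prod_list ps))) \<longlongrightarrow> exp (Phi_P r z)) (finite_subsets_at_top (prime_tuples r))"
      by (rule tendsto_exp)
    moreover have "eventually (\<lambda>X. exp (\<Sum>ps\<in>X. - Ln (1 - z ^ prod_list ps)) = (\<Prod>ps\<in>X. inverse (1 - z ^ prod_list ps)))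
        (finite_subsets_at_top (prime_tuples r))"
    proof (rule eventually_finite_subsets_at_top_weakI)
      fix X assume X: "finite X" "X \<subseteq> prime_tuples r"
      have "exp (- Ln (1 - z ^ prod_list ps)) = inverse (1 - z ^ prod_list ps)" if "ps \<in> X" for ps
      proof -
        have "norm (z ^ prod_list ps) < 1"
          using z prime_tuples_prod_pos[of ps r] that X by (auto simp: norm_power power_less_one_iff)
        then have "1 - z ^ prod_list ps \<noteq> 0" by auto
        then show ?thesis by (simp add: exp_minus)
      qed
      then show "exp (\<Sum>ps\<in>X. - Ln (1 - z ^ prod_list ps)) = (\<Prod>ps\<in>X. inverse (1 - z ^ prod_list ps))"
        using X by (simp add: exp_sum)
    qed
    ultimately have "((\<lambda>X. \<Prod>ps\<in>X. inverse (1 - z ^ prod_list ps)) \<longlongrightarrow> exp (Phi_P r z)) (finite_subsets_at_top (prime_tuples r))"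
      by (rule Lim_transform_eventually)
    then show "Psi_P r z = exp (Phi_P r z)"
      unfolding Psi_P_def unordered_prod_def by (intro tendsto_Lim) auto
  qed
  then show ?thesis unfolding a_def by blast
qed

text \<open>For \<open>r = 0\<close> both generating functions are \<open>1 / (1 - z)\<close> with
  all coefficients \<open>1\<close>, whereas the saddle point expression tends to
  \<open>exp 1 / sqrt (2 * pi)\<close>; hence \<open>r \<ge> 1\<close>. Existence of the saddle
  points is part of the conclusion, which makes the claims about \<open>\<rho>\<close> and
  \<open>\<rho>'\<close> non-vacuous.\<close>

theorem theorem8p8:
  fixes r :: nat
  assumes "r \<ge> 1"
  shows "(\<forall>\<^sub>F n in sequentially. \<exists>!x. saddle_point (Phi_P r) n x) \<and>
    (\<forall>\<^sub>F n in sequentially. \<exists>!x. saddle_point (Phi_L r) n x) \<and>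
    (\<forall>\<rho> :: nat \<Rightarrow> real. (\<forall>\<^sub>F n in sequentially. saddle_point (Phi_P r) n (\<rho> n)) \<longrightarrow>
      (\<exists>E :: nat \<Rightarrow> complex. E \<in> O(\<lambda>n. complex_of_real (real n powr (-1/6))) \<and>
        (\<forall>\<^sub>F n in sequentially.
          part_P r n = saddle_main (Psi_P r) (Phi_P r) n (\<rho> n) * (1 + E n)))) \<and>
    (\<forall>\<rho>' :: nat \<Rightarrow> real. (\<forall>\<^sub>F n in sequentially. saddle_point (Phi_L r) n (\<rho>' n)) \<longrightarrow>
      (\<exists>E :: nat \<Rightarrow> complex. E \<in> O(\<lambda>n. complex_of_real (real n powr (-1/6))) \<and>
        (\<forall>\<^sub>F n in sequentially.
          part_L r n = saddle_main (Psi_L r) (Phi_L r) n (\<rho>' n) * (1 + E n))))"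
proof -
  obtain C c s s' where "exp_series (log_coeff (tuple_count r)) C c s s' (Phi_P r) (Psi_P r)"
    using exp_series_P[OF assms] by blast
  then interpret P: exp_series "log_coeff (tuple_count r)" C c s s' "Phi_P r" "Psi_P r" .
  obtain C' c' q q' where "exp_series (log_coeff (mangoldt_conv r)) C' c' q q' (Phi_L r) (Psi_L r)"
    using exp_series_L[OF assms] by blast
  then interpret L: exp_series "log_coeff (mangoldt_conv r)" C' c' q q' "Phi_L r" "Psi_L r" .
  show ?thesis
    unfolding part_P_def part_L_def
    using P.eventually_unique_saddle_point L.eventually_unique_saddle_point
      P.coeff_saddle_asymptotics L.coeff_saddle_asymptotics by blast
qed

end
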